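(* Consider the Group-R2 prior with $G$ groups of sizes $p_1,\dots,p_G$, parameters $a_G>0$, $a_2>0$, $c_g=a_G/p_g$, and $\sigma^2=1$ (as defined in the context). If $c_g=a_2=\tfrac12$, then for every $l=1,\dots,p_g$ the marginal distribution of $b_{gl}$ is the same as that of the horseshoe prior (with global scale $1$), and therefore the Group-R2 prior has bounded influence: if $b$ has this marginal prior and $y\mid b\sim\mathrm{Normal}(b,1)$, then $$\mathbb{E}(b\mid y)-y\to0\qquad\text{as }|y|\to\infty .$$
   Context: Group-R2 prior (with $\sigma^2=1$): $R^2\sim\mathrm{Beta}(Ga_G,a_2)$ and $\tau^2=R^2/(1-R^2)$; $\phi=(\phi_1,\dots,\phi_G)$ is symmetric Dirichlet with all concentration parameters equal to $a_G$; for each $g$, $\varphi_g=(\varphi_{g1},\dots,\varphi_{gp_g})$ is symmetric Dirichlet with all concentration parameters equal to $c_g$; the variables $\tau^2,\phi,\varphi_1,\dots,\varphi_G$ are mutually independent; and conditionally on them the coefficients $b_{gl}$ are independent with $b_{gl}\sim\mathrm{Normal}(0,\varphi_{gl}\phi_g\tau^2)$ (variance parametrization). A symmetric Dirichlet in dimension $1$ is the point mass at $1$. The subscript in $a_G$ is only a label. The horseshoe prior with global scale $1$ is the law of $b$ when $b\mid\lambda\sim\mathrm{Normal}(0,\lambda^2)$ (variance $\lambda^2$) and $\lambda\sim\mathrm{Cauchy}^+(0,1)$, the standard half-Cauchy distribution on $(0,\infty)$. *)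

theory Defs
  imports "HOL-Probability.Probability"
begin

definition beta_distribution :: "real \<Rightarrow> real \<Rightarrow> real measure" where
  "beta_distribution a b = density lborel
     (\<lambda>x. ennreal (if 0 < x \<and> x < 1 then x powr (a - 1) * (1 - x) powr (b - 1) / Beta a b else 0))"

definition half_cauchy :: "real measure" where
  "half_cauchy = density lborel (\<lambda>x. ennreal (if 0 < x then 2 / (pi * (1 + x\<^sup>2)) else 0))"

(* The second argument is the variance (normal_density takes the standard deviation);
   variance 0 gives the point mass. *)
definition normal_distribution :: "real \<Rightarrow> real \<Rightarrow> real measure" where
  "normal_distribution \<mu> v =
     (if v = 0 then return borel \<mu>
      else density lborel (\<lambda>x. ennreal (normal_density \<mu> (sqrt v) x)))"

(* The Dirichlet distribution on the open simplex in the coordinates 1, ..., n: its density refers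
   to Lebesgue measure in the first n - 1 coordinates, and the last one is 1 minus their sum.
   For n = 1 this is the point mass at 1 (lemma dirichlet_1). *)
definition simplex_point :: "nat \<Rightarrow> (nat \<Rightarrow> real) \<Rightarrow> nat \<Rightarrow> real" where
  "simplex_point n x = x(n := 1 - (\<Sum>i\<in>{1..<n}. x i))"

definition dirichlet_density :: "nat \<Rightarrow> (nat \<Rightarrow> real) \<Rightarrow> (nat \<Rightarrow> real) \<Rightarrow> real" where
  "dirichlet_density n \<alpha> x =
     (if \<forall>i\<in>{1..n}. 0 < x i
      then Gamma (\<Sum>i\<in>{1..n}. \<alpha> i) / (\<Prod>i\<in>{1..n}. Gamma (\<alpha> i)) * (\<Prod>i\<in>{1..n}. x i powr (\<alpha> i - 1))
      else 0)"

definition dirichlet :: "nat \<Rightarrow> (nat \<Rightarrow> real) \<Rightarrow> (nat \<Rightarrow> real) measure" where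
  "dirichlet n \<alpha> =
     distr (density (\<Pi>\<^sub>M i\<in>{1..<n}. lborel) (\<lambda>x. ennreal (dirichlet_density n \<alpha> (simplex_point n x))))
       (\<Pi>\<^sub>M i\<in>{1..n}. borel) (simplex_point n)"

abbreviation symmetric_dirichlet :: "nat \<Rightarrow> real \<Rightarrow> (nat \<Rightarrow> real) measure" where
  "symmetric_dirichlet n a \<equiv> dirichlet n (\<lambda>_. a)"

lemma dirichlet_1:
  assumes "0 < \<alpha> 1"
  shows "dirichlet 1 \<alpha> = return (\<Pi>\<^sub>M i\<in>{1..1}. borel) (\<lambda>i\<in>{1..1}. 1)"
proof -
  have *: "simplex_point 1 (\<lambda>_. undefined) = (\<lambda>i\<in>{1..1}. 1)"
    by (auto simp: simplex_point_def fun_eq_iff)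
  have m: "simplex_point 1 \<in> measurable (count_space {\<lambda>_. undefined}) (\<Pi>\<^sub>M i\<in>{1..1}. (borel :: real measure))"
    by (auto simp: space_PiM simplex_point_def split: if_splits)
  have g: "Gamma (\<alpha> 1) \<noteq> 0"
    using assms by (metis Gamma_real_pos less_irrefl)
  have d: "density (\<Pi>\<^sub>M i\<in>{1..<1}. lborel) (\<lambda>x. ennreal (dirichlet_density 1 \<alpha> (simplex_point 1 x)))
      = count_space {\<lambda>_. undefined}"
  proof -
    have "dirichlet_density 1 \<alpha> (simplex_point 1 x) = 1" for x
      using g by (simp add: dirichlet_density_def simplex_point_def)
    then show ?thesis by (simp add: density_1 PiM_empty)
  qed
  show ?thesis
    unfolding dirichlet_def d
  proof (rule measure_eqI)
    fix A assume "A \<in> sets (distr (count_space {\<lambda>_. undefined})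
      (\<Pi>\<^sub>M i\<in>{1..1}. (borel :: real measure)) (simplex_point 1))"
    then have A: "A \<in> sets (\<Pi>\<^sub>M i\<in>{1..1}. (borel :: real measure))" by simp
    have "simplex_point 1 -` A \<inter> {\<lambda>_. undefined}
        = (if (\<lambda>i\<in>{1..1}. 1) \<in> A then {\<lambda>_. undefined} else {})"
      using * by auto
    then show "emeasure (distr (count_space {\<lambda>_. undefined})
        (\<Pi>\<^sub>M i\<in>{1..1}. (borel :: real measure)) (simplex_point 1)) A
      = emeasure (return (\<Pi>\<^sub>M i\<in>{1..1}. borel) (\<lambda>i\<in>{1..1}. 1)) A"
      unfolding emeasure_distr[OF m A] emeasure_return[OF A] space_count_space by simp
  qed simp
qed

(* The law of b = (b (g, l)), g = 1..G, l = 1..p g, for sigma^2 = 1. The variables tau^2, phi and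
   the psi g are independent, so their joint law is a product measure; the kernel gives the
   conditional law of b, with independent coordinates. *)
definition group_R2_prior ::
  "nat \<Rightarrow> (nat \<Rightarrow> nat) \<Rightarrow> real \<Rightarrow> real \<Rightarrow> (nat \<Rightarrow> real) \<Rightarrow> (nat \<times> nat \<Rightarrow> real) measure" where
  "group_R2_prior G p a\<^sub>G a\<^sub>2 c =
     distr (beta_distribution (real G * a\<^sub>G) a\<^sub>2) borel (\<lambda>R2. R2 / (1 - R2))
       \<Otimes>\<^sub>M (symmetric_dirichlet G a\<^sub>G
       \<Otimes>\<^sub>M (\<Pi>\<^sub>M g\<in>{1..G}. symmetric_dirichlet (p g) (c g)))
     \<bind> (\<lambda>(\<tau>2, \<phi>, \<psi>).
       \<Pi>\<^sub>M (g, l)\<in>(SIGMA g:{1..G}. {1..p g}). normal_distribution 0 (\<psi> g l * \<phi> g * \<tau>2))"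

definition group_R2_marginal ::
  "nat \<Rightarrow> (nat \<Rightarrow> nat) \<Rightarrow> real \<Rightarrow> real \<Rightarrow> (nat \<Rightarrow> real) \<Rightarrow> nat \<Rightarrow> nat \<Rightarrow> real measure" where
  "group_R2_marginal G p a\<^sub>G a\<^sub>2 c g l = distr (group_R2_prior G p a\<^sub>G a\<^sub>2 c) borel (\<lambda>b. b (g, l))"

definition horseshoe_prior :: "real measure" where
  "horseshoe_prior = half_cauchy \<bind> (\<lambda>s. normal_distribution 0 (s\<^sup>2))"

(* Posterior law of b given y for the prior P and y | b ~ Normal(b, 1), by Bayes' formula. It is
   defined for every y, and it is a version of the conditional law (lemma posterior_disintegration);
   real_cond_exp would determine E(b | y) only up to null sets, and only for integrable b. *)
definition posterior :: "real measure \<Rightarrow> real \<Rightarrow> real measure" where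
  "posterior P y =
     density P (\<lambda>b. ennreal (normal_density b 1 y / (\<integral>b'. normal_density b' 1 y \<partial>P)))"

definition posterior_mean :: "real measure \<Rightarrow> real \<Rightarrow> real" where
  "posterior_mean P y = (\<integral>b. b \<partial>posterior P y)"

lemma posterior_disintegration:
  fixes P :: "real measure"
  assumes P: "prob_space P" and [measurable_cong]: "sets P = sets borel"
    and [measurable]: "A \<in> sets borel" "B \<in> sets borel"
  shows "(\<integral>\<^sup>+b. indicator A b * emeasure (normal_distribution b 1) B \<partial>P)
       = (\<integral>\<^sup>+y. indicator B y * emeasure (posterior P y) A \<partial>(P \<bind> (\<lambda>b. normal_distribution b 1)))"
proof -
  interpret prob_space P by fact
  interpret pair_sigma_finite P lborel ..
  let ?n = "\<lambda>b y :: real. normal_density b 1 y"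
  define m where "m y = (\<integral>b. ?n b y \<partial>P)" for y
  have n_alt: "?n b y = exp (- (y - b)\<^sup>2 / 2) / sqrt (2 * pi)" for b y
    by (simp add: normal_density_def)
  have n_meas[measurable]: "(\<lambda>(b, y). ?n b y) \<in> borel_measurable (borel \<Otimes>\<^sub>M borel)"
    by (simp add: n_alt)
  have int: "integrable P (\<lambda>b. ?n b y)" for y
    by (rule integrable_const_bound[where B="1 / sqrt (2 * pi)"])
      (auto simp: n_alt divide_simps)
  have m_pos: "0 < m y" for y
  proof -
    have "m y \<noteq> 0"
      unfolding m_def
      using integral_nonneg_eq_0_iff_AE[OF int[of y]] normal_density_pos[of 1 _ y]
      by (auto simp: less_le AE_False)
    moreover have "0 \<le> m y" by (simp add: m_def)
    ultimately show ?thesis by simp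
  qed
  have m_eq: "(\<integral>\<^sup>+b. ennreal (?n b y) \<partial>P) = ennreal (m y)" for y
    unfolding m_def by (intro nn_integral_eq_integral int) simp
  have [measurable]: "m \<in> borel_measurable borel"
    unfolding m_def n_alt by measurable
  have N: "normal_distribution b 1 = density lborel (\<lambda>y. ennreal (?n b y))" for b
    by (simp add: normal_distribution_def)
  have K: "(\<lambda>b. normal_distribution b 1) \<in> measurable P (subprob_algebra borel)"
  proof (rule measurable_subprob_algebra)
    show "subprob_space (normal_distribution b 1)" for b
      unfolding N by (intro prob_space_imp_subprob_space prob_space_normal_density) simp
    show "sets (normal_distribution b 1) = sets borel" for b by (simp add: N)
    show "(\<lambda>b. emeasure (normal_distribution b 1) C) \<in> borel_measurable P"
      if [measurable]: "C \<in> sets borel" for C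
      by (simp add: N emeasure_density n_alt)
  qed
  have post: "emeasure (posterior P y) A = (\<integral>\<^sup>+b. indicator A b * ennreal (?n b y) \<partial>P) / ennreal (m y)" for y
  proof -
    have "emeasure (posterior P y) A = (\<integral>\<^sup>+b. ennreal (?n b y / m y) * indicator A b \<partial>P)"
      unfolding posterior_def m_def[symmetric] by (intro emeasure_density) (simp_all add: n_alt)
    also have "\<dots> = (\<integral>\<^sup>+b. (indicator A b * ennreal (?n b y)) / ennreal (m y) \<partial>P)"
      by (intro nn_integral_cong) (simp add: divide_ennreal[symmetric] m_pos ennreal_times_divide mult.commute)
    finally show ?thesis by (simp add: nn_integral_divide n_alt)
  qed
  have [measurable]: "(\<lambda>y. emeasure (posterior P y) A) \<in> borel_measurable borel"
    unfolding post n_alt by measurable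
  have "(\<integral>\<^sup>+y. indicator B y * emeasure (posterior P y) A \<partial>(P \<bind> (\<lambda>b. normal_distribution b 1)))
      = (\<integral>\<^sup>+b. \<integral>\<^sup>+y. indicator B y * emeasure (posterior P y) A \<partial>normal_distribution b 1 \<partial>P)"
    by (rule nn_integral_bind[OF _ K]) simp
  also have "\<dots> = (\<integral>\<^sup>+b. \<integral>\<^sup>+y. ennreal (?n b y) * (indicator B y * emeasure (posterior P y) A) \<partial>lborel \<partial>P)"
    by (simp add: N nn_integral_density)
  also have "\<dots> = (\<integral>\<^sup>+y. \<integral>\<^sup>+b. ennreal (?n b y) * (indicator B y * emeasure (posterior P y) A) \<partial>P \<partial>lborel)"
    by (rule Fubini'[symmetric]) (simp add: n_alt split_beta')
  also have "\<dots> = (\<integral>\<^sup>+y. ennreal (m y) * (indicator B y * emeasure (posterior P y) A) \<partial>lborel)"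
    by (simp add: nn_integral_multc m_eq n_alt flip: n_alt)
  also have "\<dots> = (\<integral>\<^sup>+y. indicator B y * (\<integral>\<^sup>+b. indicator A b * ennreal (?n b y) \<partial>P) \<partial>lborel)"
  proof -
    have "ennreal (m y) * (u * (v / ennreal (m y))) = u * v" for u v y
      using m_pos[of y]
      by (metis ennreal_eq_0_iff ennreal_mult_divide_eq ennreal_neq_top ennreal_times_divide
        mult.commute mult.left_commute not_le)
    then show ?thesis by (simp add: post)
  qed
  also have "\<dots> = (\<integral>\<^sup>+y. \<integral>\<^sup>+b. indicator B y * (indicator A b * ennreal (?n b y)) \<partial>P \<partial>lborel)"
    by (simp add: nn_integral_cmult n_alt)
  also have "\<dots> = (\<integral>\<^sup>+b. \<integral>\<^sup>+y. indicator B y * (indicator A b * ennreal (?n b y)) \<partial>lborel \<partial>P)"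
    by (rule Fubini') (simp add: n_alt split_beta')
  also have "\<dots> = (\<integral>\<^sup>+b. indicator A b * emeasure (normal_distribution b 1) B \<partial>P)"
    by (intro nn_integral_cong)
      (simp add: N emeasure_density nn_integral_cmult[symmetric] mult_ac)
  finally show ?thesis by simp
qed

end

theory Submission
  imports Defs
begin

text \<open>
  The kernels \<open>x\<^sup>a\<^sup>-\<^sup>1 / \<Gamma>(a)\<close> on \<open>(0, \<infinity>)\<close> form a convolution semigroup, so the coordinates of a Dirichlet
  vector are Beta distributed. If \<open>w\<close> is \<open>Beta(a, b)\<close> and \<open>t\<close> is an independent \<open>Gamma(a + b)\<close>, then \<open>w t\<close>
  and \<open>(1 - w) t\<close> are independent \<open>Gamma(a)\<close> and \<open>Gamma(b)\<close>. Writing the Beta prime law of \<open>\<tau>\<^sup>2\<close> as that of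
  a ratio of two Gamma variables, the factors \<open>\<phi>\<^sub>g\<close> and \<open>\<psi>\<^sub>g\<^sub>l\<close> successively lower the first parameter, from
  \<open>G a\<^sub>G\<close> to \<open>a\<^sub>G\<close> and then to \<open>c\<^sub>g\<close>. For \<open>c\<^sub>g = a\<^sub>2 = 1/2\<close> the variance is the square of a half-Cauchy variable.

  Given \<open>s\<close>, the posterior mean of \<open>b\<close> under \<open>Normal(0, s\<^sup>2)\<close> is \<open>y - y / (1 + s\<^sup>2)\<close>. Hence \<open>E(b | y) - y = - y N / Z\<close>
  with \<open>Z\<close> the marginal density of \<open>y\<close> and \<open>N\<close> its integrand weighted by \<open>1 / (1 + s\<^sup>2)\<close>. Scales
  \<open>s \<in> [|y|, 2|y|]\<close> already give \<open>Z \<ge> C / y\<^sup>2\<close>, while \<open>|y|\<^sup>3 N \<longrightarrow> 0\<close> by dominated convergence.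
\<close>

section \<open>Gamma, Beta and Beta prime distributions\<close>

text \<open>The Gamma(a) density without its exponential factor (the Riemann-Liouville kernel).
  Dividing by \<open>Gamma a\<close> makes convolution add parameters with no constant. The value 0
  off the positive axis lets every integral run over the whole line.\<close>

definition power_kernel :: "real \<Rightarrow> real \<Rightarrow> real" where
  "power_kernel a x = (if 0 < x then x powr (a - 1) / Gamma a else 0)"

definition gamma_distribution :: "real \<Rightarrow> real measure" where
  "gamma_distribution a = density lborel (\<lambda>x. ennreal (power_kernel a x * exp (- x)))"

text \<open>Encoded as the law of a ratio of independent Gamma variables rather than by a density: a
  random factor can then be absorbed into the numerator alone.\<close>

definition beta_prime_distribution :: "real \<Rightarrow> real \<Rightarrow> real measure" where
  "beta_prime_distribution a b =
     distr (gamma_distribution a \<Otimes>\<^sub>M gamma_distribution b) borel (\<lambda>(y, s). y / s)"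

lemma power_kernel_measurable [measurable]: "power_kernel a \<in> borel_measurable borel"
  unfolding power_kernel_def by measurable

lemma power_kernel_nonneg: "0 < a \<Longrightarrow> 0 \<le> power_kernel a x"
  by (auto simp: power_kernel_def intro!: divide_nonneg_nonneg less_imp_le[OF Gamma_real_pos])

lemma power_kernel_scale:
  "0 < t \<Longrightarrow> power_kernel a (t * x) = t powr (a - 1) * power_kernel a x"
  by (auto simp: power_kernel_def powr_mult zero_less_mult_iff)

lemma beta_distribution_eq_power_kernel:
  assumes "0 < a" "0 < b"
  shows "beta_distribution a b =
    density lborel (\<lambda>x. ennreal (Gamma (a + b) * (power_kernel a x * power_kernel b (1 - x))))"
  unfolding beta_distribution_def
  by (rule arg_cong[where f="density lborel"])
    (auto simp: fun_eq_iff power_kernel_def Beta_def mult_ac)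

lemma sets_distributions [simp, measurable_cong]:
  "sets (beta_distribution a b) = sets borel"
  "sets (gamma_distribution a) = sets borel"
  "sets (beta_prime_distribution a b) = sets borel"
  "sets half_cauchy = sets borel"
  "sets (normal_distribution \<mu> v) = sets borel"
  by (simp_all add: beta_distribution_def gamma_distribution_def beta_prime_distribution_def
      half_cauchy_def normal_distribution_def)

lemma space_distributions [simp]:
  "space (beta_distribution a b) = UNIV"
  "space (gamma_distribution a) = UNIV"
  "space (beta_prime_distribution a b) = UNIV"
  "space half_cauchy = UNIV"
  "space (normal_distribution \<mu> v) = UNIV"
  by (simp_all add: sets_eq_imp_space_eq[OF sets_distributions(1)]
    sets_eq_imp_space_eq[OF sets_distributions(2)] sets_eq_imp_space_eq[OF sets_distributions(3)]
    sets_eq_imp_space_eq[OF sets_distributions(4)] sets_eq_imp_space_eq[OF sets_distributions(5)])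

lemma prob_space_beta_distribution:
  assumes "0 < a" "0 < b"
  shows "prob_space (beta_distribution a b)"
proof
  have B: "0 < Beta a b"
    using assms by (simp add: Beta_def)
  \<comment> \<open>The closed interval of the Beta integral may replace the open one: since
    \<open>0 powr z = 0\<close>, the integrand vanishes at both endpoints.\<close>
  have "emeasure (beta_distribution a b) UNIV =
    (\<integral>\<^sup>+x. ennreal ((x powr (a - 1) * (1 - x) powr (b - 1)) / Beta a b) * indicator {0..1} x \<partial>lborel)"
    unfolding beta_distribution_def
    by (subst emeasure_density) (auto intro!: nn_integral_cong simp: indicator_def)
  also have "\<dots> = ennreal (Beta a b / Beta a b)"
    using B by (intro nn_integral_has_integral_lebesgue' has_integral_divide has_integral_Beta_real assms) auto
  finally show "emeasure (beta_distribution a b) (space (beta_distribution a b)) = 1"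
    using B by simp
qed

lemma prob_space_gamma_distribution:
  assumes "0 < a"
  shows "prob_space (gamma_distribution a)"
proof
  have G: "0 < Gamma a"
    using assms by simp
  have "emeasure (gamma_distribution a) UNIV =
    (\<integral>\<^sup>+x. ennreal ((x powr (a - 1) / exp x) / Gamma a) * indicator {0..} x \<partial>lborel)"
    unfolding gamma_distribution_def
    by (subst emeasure_density)
      (auto intro!: nn_integral_cong simp: indicator_def power_kernel_def exp_minus field_simps)
  also have "\<dots> = ennreal (Gamma a / Gamma a)"
    using G by (intro nn_integral_has_integral_lebesgue' has_integral_divide Gamma_integral_real assms) auto
  finally show "emeasure (gamma_distribution a) (space (gamma_distribution a)) = 1"
    using G by simp
qed

lemma prob_space_beta_prime_distribution:
  assumes "0 < a" "0 < b"
  shows "prob_space (beta_prime_distribution a b)"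
proof -
  interpret A: prob_space "gamma_distribution a" by (rule prob_space_gamma_distribution) fact
  interpret B: prob_space "gamma_distribution b" by (rule prob_space_gamma_distribution) fact
  interpret pair_prob_space "gamma_distribution a" "gamma_distribution b" ..
  show ?thesis
    unfolding beta_prime_distribution_def by (rule prob_space_distr) measurable
qed

section \<open>Convolution of power kernels and the Beta-Gamma identity\<close>

lemma ennreal_mult_left_assoc:
  "0 \<le> a \<Longrightarrow> ennreal a * (ennreal b * c) = ennreal (a * b) * c"
  by (simp add: ennreal_mult' mult.assoc)

text \<open>The substitution \<open>x = s * u\<close> turns the convolution into a Beta integral
  times a power of s. For \<open>s \<le> 0\<close> the arguments x and s - x are never both
  positive, so both sides vanish.\<close>

lemma nn_integral_power_kernel_conv:
  assumes "0 < a" "0 < b"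
  shows "(\<integral>\<^sup>+x. ennreal (power_kernel a x * power_kernel b (s - x)) \<partial>lborel) = ennreal (power_kernel (a + b) s)"
proof (cases "0 < s")
  case False
  then have *: "power_kernel a x * power_kernel b (s - x) = 0" "power_kernel (a + b) s = 0" for x
    by (simp_all add: power_kernel_def)
  show ?thesis
    unfolding * by simp
next
  case True
  have G: "0 < Gamma (a + b)" using assms by simp
  interpret prob_space "beta_distribution a b" by (rule prob_space_beta_distribution) fact+
  let ?k = "\<lambda>u. Gamma (a + b) * (power_kernel a u * power_kernel b (1 - u))"
  have "(\<integral>\<^sup>+x. ennreal (power_kernel a x * power_kernel b (s - x)) \<partial>lborel)
    = ennreal \<bar>s\<bar> * (\<integral>\<^sup>+u. ennreal (power_kernel a (0 + s * u) * power_kernel b (s - (0 + s * u))) \<partial>lborel)"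
    using True by (intro nn_integral_real_affine) auto
  also have "\<dots> = ennreal \<bar>s\<bar> * (\<integral>\<^sup>+u. ennreal (s powr (a - 1) * s powr (b - 1) / Gamma (a + b)) * ennreal (?k u) \<partial>lborel)"
  proof -
    have "power_kernel b (s - s * u) = s powr (b - 1) * power_kernel b (1 - u)" for u
      using power_kernel_scale[OF True, of b "1 - u"] by (simp add: algebra_simps)
    then show ?thesis
      using G True by (auto intro!: arg_cong2[where f="(*)"] nn_integral_cong
        simp: power_kernel_scale ennreal_mult'[symmetric] less_imp_le mult.assoc mult.left_commute)
  qed
  also have "\<dots> = ennreal \<bar>s\<bar> * ennreal (s powr (a - 1) * s powr (b - 1) / Gamma (a + b)) * (\<integral>\<^sup>+u. ennreal (?k u) \<partial>lborel)"
    by (simp add: nn_integral_cmult mult.assoc)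
  \<comment> \<open>\<open>?k\<close> is the Beta(a, b) density written with power kernels, so its
    total mass is 1.\<close>
  also have "(\<integral>\<^sup>+u. ennreal (?k u) \<partial>lborel) = 1"
    using emeasure_space_1 beta_distribution_eq_power_kernel[OF assms]
    by (simp add: emeasure_density)
  also have "ennreal \<bar>s\<bar> * ennreal (s powr (a - 1) * s powr (b - 1) / Gamma (a + b)) * 1
    = ennreal (power_kernel (a + b) s)"
  proof -
    have "s powr (a + b - 1) = s powr (1 + (a - 1) + (b - 1))" by (simp add: algebra_simps)
    also have "\<dots> = s * s powr (a - 1) * s powr (b - 1)"
      unfolding powr_add using True by simp
    finally show ?thesis
      using True G by (simp add: power_kernel_def ennreal_mult'[symmetric] mult_ac)
  qed
  finally show ?thesis .
qed

lemma nn_integral_gamma_distribution: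
  assumes "f \<in> borel_measurable borel"
  shows "(\<integral>\<^sup>+x. f x \<partial>gamma_distribution a) = (\<integral>\<^sup>+x. ennreal (power_kernel a x * exp (- x)) * f x \<partial>lborel)"
  using assms unfolding gamma_distribution_def by (intro nn_integral_density) auto

text \<open>The change of variables t = y + s, w = y / t, whose Jacobian is t. It is carried out as
  two affine substitutions in one variable, a shift and a scaling, with an exchange of integrals
  between them. The test function F of both products captures their joint law, hence also
  independence.\<close>

lemma nn_integral_beta_gamma:
  fixes F :: "real \<Rightarrow> real \<Rightarrow> ennreal"
  assumes ab: "0 < a" "0 < b"
    and [measurable]: "(\<lambda>(y, s). F y s) \<in> borel_measurable (borel \<Otimes>\<^sub>M borel)"
  shows "(\<integral>\<^sup>+w. \<integral>\<^sup>+t. F (w * t) ((1 - w) * t) \<partial>gamma_distribution (a + b) \<partial>beta_distribution a b)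
    = (\<integral>\<^sup>+y. \<integral>\<^sup>+s. F y s \<partial>gamma_distribution b \<partial>gamma_distribution a)"
proof -
  note G = Gamma_real_pos[OF ab(1)] Gamma_real_pos[OF ab(2)] Gamma_real_pos[OF add_pos_pos[OF ab]]
  have "(\<integral>\<^sup>+y. \<integral>\<^sup>+s. F y s \<partial>gamma_distribution b \<partial>gamma_distribution a)
    = (\<integral>\<^sup>+y. ennreal (power_kernel a y * exp (- y)) *
         (\<integral>\<^sup>+s. ennreal (power_kernel b s * exp (- s)) * F y s \<partial>lborel) \<partial>lborel)"
    by (simp add: nn_integral_gamma_distribution)
  \<comment> \<open>Shift \<open>s = t - y\<close> for fixed y; the two exponentials then combine to
    \<open>exp (- t)\<close>.\<close>
  also have "\<dots> = (\<integral>\<^sup>+y. ennreal (power_kernel a y * exp (- y)) *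
         (\<integral>\<^sup>+t. ennreal (power_kernel b (t - y) * exp (y - t)) * F y (t - y) \<partial>lborel) \<partial>lborel)"
  proof (rule nn_integral_cong, rule arg_cong2[where f="(*)", OF refl])
    fix y :: real
    show "(\<integral>\<^sup>+s. ennreal (power_kernel b s * exp (- s)) * F y s \<partial>lborel)
      = (\<integral>\<^sup>+t. ennreal (power_kernel b (t - y) * exp (y - t)) * F y (t - y) \<partial>lborel)"
      by (subst nn_integral_real_affine[where c=1 and t="- y"]) simp_all
  qed
  also have "\<dots> = (\<integral>\<^sup>+y. \<integral>\<^sup>+t. ennreal (power_kernel a y * power_kernel b (t - y) * exp (- t)) * F y (t - y) \<partial>lborel \<partial>lborel)"
  proof (rule nn_integral_cong)
    fix y :: real
    have *: "power_kernel a y * exp (- y) * (power_kernel b (t - y) * exp (y - t))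
      = power_kernel a y * power_kernel b (t - y) * exp (- t)" for t
      using exp_add[of "- y" "y - t"] by simp
    show "ennreal (power_kernel a y * exp (- y)) *
         (\<integral>\<^sup>+t. ennreal (power_kernel b (t - y) * exp (y - t)) * F y (t - y) \<partial>lborel)
      = (\<integral>\<^sup>+t. ennreal (power_kernel a y * power_kernel b (t - y) * exp (- t)) * F y (t - y) \<partial>lborel)"
      using ab by (subst nn_integral_cmult[symmetric])
        (simp_all add: ennreal_mult_left_assoc power_kernel_nonneg *)
  qed
  also have "\<dots> = (\<integral>\<^sup>+t. \<integral>\<^sup>+y. ennreal (power_kernel a y * power_kernel b (t - y) * exp (- t)) * F y (t - y) \<partial>lborel \<partial>lborel)"
    by (rule lborel_pair.Fubini'[symmetric]) measurable
  \<comment> \<open>Scaling \<open>y = t * w\<close> for fixed t.\<close>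
  also have "\<dots> = (\<integral>\<^sup>+t. \<integral>\<^sup>+w. ennreal (Gamma (a + b) * (power_kernel a w * power_kernel b (1 - w)) *
      (power_kernel (a + b) t * exp (- t))) * F (w * t) ((1 - w) * t) \<partial>lborel \<partial>lborel)"
  proof (rule nn_integral_cong)
    fix t :: real
    show "(\<integral>\<^sup>+y. ennreal (power_kernel a y * power_kernel b (t - y) * exp (- t)) * F y (t - y) \<partial>lborel)
      = (\<integral>\<^sup>+w. ennreal (Gamma (a + b) * (power_kernel a w * power_kernel b (1 - w)) *
          (power_kernel (a + b) t * exp (- t))) * F (w * t) ((1 - w) * t) \<partial>lborel)"
    proof (cases "0 < t")
      case False
      then have *: "power_kernel a y * power_kernel b (t - y) = 0" "power_kernel (a + b) t = 0" for y
        by (simp_all add: power_kernel_def)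
      show ?thesis unfolding * by simp
    next
      case True
      have k: "power_kernel b (t - t * w) = t powr (b - 1) * power_kernel b (1 - w)" for w
        using power_kernel_scale[OF True, of b "1 - w"] by (simp add: algebra_simps)
      \<comment> \<open>The Jacobian t and the powers extracted from both kernels multiply to the
        power of the Gamma(a + b) kernel.\<close>
      have p: "t * (t powr (a - 1) * t powr (b - 1)) = Gamma (a + b) * power_kernel (a + b) t"
      proof -
        have "t powr (a + b - 1) = t powr (1 + (a - 1) + (b - 1))" by (simp add: algebra_simps)
        also have "\<dots> = t * (t powr (a - 1) * t powr (b - 1))"
          unfolding powr_add using True by simp
        finally show ?thesis using True by (simp add: power_kernel_def less_imp_neq[OF G(3), THEN not_sym])
      qed
      have e: "t * (power_kernel a (t * w) * power_kernel b (t - t * w) * exp (- t)) =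
        Gamma (a + b) * (power_kernel a w * power_kernel b (1 - w)) * (power_kernel (a + b) t * exp (- t))" for w
      proof -
        have "t * (power_kernel a (t * w) * power_kernel b (t - t * w) * exp (- t)) =
          (t * (t powr (a - 1) * t powr (b - 1))) * (power_kernel a w * power_kernel b (1 - w) * exp (- t))"
          by (simp add: k power_kernel_scale[OF True])
        then show ?thesis unfolding p by simp
      qed
      have "(\<integral>\<^sup>+y. ennreal (power_kernel a y * power_kernel b (t - y) * exp (- t)) * F y (t - y) \<partial>lborel)
        = ennreal \<bar>t\<bar> * (\<integral>\<^sup>+w. ennreal (power_kernel a (0 + t * w) * power_kernel b (t - (0 + t * w)) * exp (- t))
            * F (0 + t * w) (t - (0 + t * w)) \<partial>lborel)"
        using True by (intro nn_integral_real_affine) auto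
      also have "\<dots> = (\<integral>\<^sup>+w. ennreal (t * (power_kernel a (t * w) * power_kernel b (t - t * w) * exp (- t)))
            * F (t * w) (t - t * w) \<partial>lborel)"
        using True by (simp add: nn_integral_cmult[symmetric] ennreal_mult' mult.assoc)
      finally show ?thesis
        unfolding e by (simp add: algebra_simps)
    qed
  qed
  also have "\<dots> = (\<integral>\<^sup>+w. \<integral>\<^sup>+t. ennreal (Gamma (a + b) * (power_kernel a w * power_kernel b (1 - w)) *
      (power_kernel (a + b) t * exp (- t))) * F (w * t) ((1 - w) * t) \<partial>lborel \<partial>lborel)"
    by (rule lborel_pair.Fubini') measurable
  also have "\<dots> = (\<integral>\<^sup>+w. ennreal (Gamma (a + b) * (power_kernel a w * power_kernel b (1 - w))) *
      (\<integral>\<^sup>+t. ennreal (power_kernel (a + b) t * exp (- t)) * F (w * t) ((1 - w) * t) \<partial>lborel) \<partial>lborel)"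
    by (rule nn_integral_cong, subst nn_integral_cmult[symmetric])
      (simp_all add: ennreal_mult_left_assoc power_kernel_nonneg ab G less_imp_le)
  also have "\<dots> = (\<integral>\<^sup>+w. \<integral>\<^sup>+t. F (w * t) ((1 - w) * t) \<partial>gamma_distribution (a + b) \<partial>beta_distribution a b)"
    by (simp add: nn_integral_gamma_distribution beta_distribution_eq_power_kernel[OF ab] nn_integral_density)
  finally show ?thesis by simp
qed

text \<open>Substitution on the compact intervals \<open>{0..n}\<close> and \<open>{0..n^2}\<close>,
  followed by continuity of measures from below; both families exhaust the half-line.\<close>

lemma nn_integral_square_substitution:
  fixes f :: "real \<Rightarrow> real"
  assumes f [measurable]: "f \<in> borel_measurable borel" and nn: "\<And>x. 0 \<le> f x"
  shows "(\<integral>\<^sup>+x. ennreal (f x) * indicator {0..} x \<partial>lborel)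
    = (\<integral>\<^sup>+x. ennreal (f (x\<^sup>2) * (2 * x)) * indicator {0..} x \<partial>lborel)"
proof -
  have sq: "(\<Union>n. {0..(real n)\<^sup>2}) = {0..}" "(\<Union>n. {0..real n}) = {0..}"
  proof -
    have "\<exists>n. x \<le> (real n)\<^sup>2" for x
    proof -
      obtain n where n: "\<bar>x\<bar> + 1 \<le> real n" using real_arch_simple by blast
      have "1 * real n \<le> real n * real n"
        using n by (intro mult_right_mono) auto
      with n show ?thesis by (intro exI[of _ n]) (simp add: power2_eq_square)
    qed
    then show "(\<Union>n. {0..(real n)\<^sup>2}) = {0..}" by auto
    show "(\<Union>n. {0..real n}) = {0..}" using real_arch_simple by auto
  qed
  have "(\<integral>\<^sup>+x. ennreal (f x) * indicator {0..} x \<partial>lborel)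
    = emeasure (density lborel (\<lambda>x. ennreal (f x))) (\<Union>n. {0..(real n)\<^sup>2})"
    by (simp add: sq emeasure_density)
  also have "\<dots> = (SUP n. emeasure (density lborel (\<lambda>x. ennreal (f x))) {0..(real n)\<^sup>2})"
    by (intro SUP_emeasure_incseq[symmetric]) (auto simp: incseq_def intro: order_trans power_mono)
  also have "\<dots> = (SUP n. emeasure (density lborel (\<lambda>x. ennreal (f (x\<^sup>2) * (2 * x)))) {0..real n})"
  proof (intro SUP_cong refl)
    fix n :: nat
    have "(\<integral>\<^sup>+x. f x * indicator {0\<^sup>2..(real n)\<^sup>2} x \<partial>lborel)
      = (\<integral>\<^sup>+x. f (x\<^sup>2) * (2 * x) * indicator {0..real n} x \<partial>lborel)"
      by (rule nn_integral_substitution)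
        (auto intro!: derivative_eq_intros continuous_intros simp: set_borel_measurable_def)
    moreover have "emeasure (density lborel (\<lambda>x. ennreal (h x))) {a..b}
      = (\<integral>\<^sup>+x. h x * indicator {a..b} x \<partial>lborel)" if "h \<in> borel_measurable borel" for h :: "real \<Rightarrow> real" and a b
      using that by (subst emeasure_density) (auto intro!: nn_integral_cong split: split_indicator)
    ultimately show "emeasure (density lborel (\<lambda>x. ennreal (f x))) {0..(real n)\<^sup>2}
      = emeasure (density lborel (\<lambda>x. ennreal (f (x\<^sup>2) * (2 * x)))) {0..real n}"
      by simp
  qed
  also have "\<dots> = emeasure (density lborel (\<lambda>x. ennreal (f (x\<^sup>2) * (2 * x)))) (\<Union>n. {0..real n})"
    by (intro SUP_emeasure_incseq) (auto simp: incseq_def)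
  also have "\<dots> = (\<integral>\<^sup>+x. ennreal (f (x\<^sup>2) * (2 * x)) * indicator {0..} x \<partial>lborel)"
    by (simp add: sq emeasure_density)
  finally show ?thesis .
qed

section \<open>Marginals of the Dirichlet distribution\<close>

lemma product_sigma_finite_lborel: "product_sigma_finite (\<lambda>_. lborel :: real measure)"
  by standard

text \<open>An iterated convolution: each coordinate integrated out adds its parameter to b. This is
  why b is generalised in the induction.\<close>

lemma nn_integral_power_kernel_PiM:
  assumes "finite J" "0 < b" "\<And>j. j \<in> J \<Longrightarrow> 0 < \<alpha> j"
  shows "(\<integral>\<^sup>+x. ennreal (power_kernel b (s - (\<Sum>j\<in>J. x j)) * (\<Prod>j\<in>J. power_kernel (\<alpha> j) (x j)))
      \<partial>(\<Pi>\<^sub>M j\<in>J. lborel)) = ennreal (power_kernel (b + (\<Sum>j\<in>J. \<alpha> j)) s)"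
  using assms
proof (induction J arbitrary: b rule: finite_induct)
  case empty
  then show ?case
    by (simp add: PiM_empty)
next
  case (insert i J)
  interpret product_sigma_finite "\<lambda>_. lborel :: real measure"
    by (rule product_sigma_finite_lborel)
  let ?P = "\<lambda>x. \<Prod>j\<in>J. power_kernel (\<alpha> j) (x j)"
  have nn: "0 \<le> ?P x" for x
    using insert.prems by (intro prod_nonneg ballI power_kernel_nonneg) auto
  have upd: "(\<Sum>j\<in>J. (x(i := y)) j) = (\<Sum>j\<in>J. x j)"
    "(\<Prod>j\<in>J. power_kernel (\<alpha> j) ((x(i := y)) j)) = ?P x" for x :: "'a \<Rightarrow> real" and y
    using insert.hyps by (auto intro!: sum.cong prod.cong)
  have "(\<integral>\<^sup>+x. ennreal (power_kernel b (s - (\<Sum>j\<in>insert i J. x j)) * (\<Prod>j\<in>insert i J. power_kernel (\<alpha> j) (x j)))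
      \<partial>(\<Pi>\<^sub>M j\<in>insert i J. lborel))
    = (\<integral>\<^sup>+x. \<integral>\<^sup>+y. ennreal (power_kernel b (s - (y + (\<Sum>j\<in>J. x j))) * (power_kernel (\<alpha> i) y * ?P x))
      \<partial>lborel \<partial>(\<Pi>\<^sub>M j\<in>J. lborel))"
    using insert.hyps by (subst product_nn_integral_insert) (auto simp: upd fun_upd_same simp del: fun_upd_apply)
  \<comment> \<open>For fixed remaining coordinates the inner integral is a convolution evaluated at
    \<open>s\<close> minus their sum.\<close>
  also have "\<dots> = (\<integral>\<^sup>+x. ennreal (power_kernel (\<alpha> i + b) (s - (\<Sum>j\<in>J. x j)) * ?P x) \<partial>(\<Pi>\<^sub>M j\<in>J. lborel))"
  proof (rule nn_integral_cong)
    fix x :: "'a \<Rightarrow> real"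
    have "(\<integral>\<^sup>+y. ennreal (power_kernel b (s - (y + (\<Sum>j\<in>J. x j))) * (power_kernel (\<alpha> i) y * ?P x)) \<partial>lborel)
      = (\<integral>\<^sup>+y. ennreal (?P x) * ennreal (power_kernel (\<alpha> i) y * power_kernel b (s - (\<Sum>j\<in>J. x j) - y)) \<partial>lborel)"
      using nn by (intro nn_integral_cong) (simp add: ennreal_mult'[symmetric] algebra_simps)
    also have "\<dots> = ennreal (?P x) * ennreal (power_kernel (\<alpha> i + b) (s - (\<Sum>j\<in>J. x j)))"
      using insert.prems by (simp add: nn_integral_cmult nn_integral_power_kernel_conv)
    finally show "(\<integral>\<^sup>+y. ennreal (power_kernel b (s - (y + (\<Sum>j\<in>J. x j))) * (power_kernel (\<alpha> i) y * ?P x)) \<partial>lborel)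
      = ennreal (power_kernel (\<alpha> i + b) (s - (\<Sum>j\<in>J. x j)) * ?P x)"
      using nn by (simp add: ennreal_mult'[symmetric] mult.commute)
  qed
  also have "\<dots> = ennreal (power_kernel (\<alpha> i + b + (\<Sum>j\<in>J. \<alpha> j)) s)"
    using insert.prems by (intro insert.IH) (auto intro: add_pos_pos)
  finally show ?case
    using insert.hyps by (simp add: add_ac)
qed

lemma measurable_simplex_point:
  assumes "1 \<le> n"
  shows "simplex_point n \<in> measurable (\<Pi>\<^sub>M i\<in>{1..<n}. lborel) (\<Pi>\<^sub>M i\<in>{1..n}. borel)"
proof -
  have [measurable]: "(\<lambda>x. x) \<in> measurable (\<Pi>\<^sub>M i\<in>{1..<n}. lborel) (\<Pi>\<^sub>M i\<in>{1..<n}. (borel :: real measure))"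
    by (rule measurable_ident_sets) (intro sets_PiM_cong; simp)
  have "{1..n} = {1..<n} \<union> {n}"
    using assms by auto
  then show ?thesis
    unfolding simplex_point_def by (rule measurable_fun_upd) measurable
qed

text \<open>The kernels absorb the positivity test of the density, because a product of kernels
  vanishes as soon as one coordinate is not positive. The factor of the dependent coordinate n is
  split off, in the shape of \<open>nn_integral_power_kernel_PiM\<close>.\<close>

lemma dirichlet_density_simplex_point:
  assumes "1 \<le> n"
  shows "dirichlet_density n \<alpha> (simplex_point n x) = Gamma (\<Sum>i\<in>{1..n}. \<alpha> i) *
    (power_kernel (\<alpha> n) (1 - (\<Sum>i\<in>{1..<n}. x i)) * (\<Prod>i\<in>{1..<n}. power_kernel (\<alpha> i) (x i)))"
proof -
  have "dirichlet_density n \<alpha> z = Gamma (\<Sum>i\<in>{1..n}. \<alpha> i) * (\<Prod>i\<in>{1..n}. power_kernel (\<alpha> i) (z i))" for z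
    by (auto simp: dirichlet_density_def power_kernel_def prod_dividef intro!: prod_zero bexI)
  moreover have "(\<Prod>i\<in>{1..n}. power_kernel (\<alpha> i) (simplex_point n x i))
    = power_kernel (\<alpha> n) (simplex_point n x n) * (\<Prod>i\<in>{1..<n}. power_kernel (\<alpha> i) (simplex_point n x i))"
  proof -
    have "{1..n} = insert n {1..<n}" using assms by auto
    then show ?thesis by simp
  qed
  moreover have "(\<Prod>i\<in>{1..<n}. power_kernel (\<alpha> i) (simplex_point n x i)) = (\<Prod>i\<in>{1..<n}. power_kernel (\<alpha> i) (x i))"
    by (intro prod.cong) (auto simp: simplex_point_def)
  ultimately show ?thesis
    by (simp add: simplex_point_def)
qed

lemma sets_dirichlet [simp, measurable_cong]: "sets (dirichlet n \<alpha>) = sets (\<Pi>\<^sub>M i\<in>{1..n}. borel)"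
  by (simp add: dirichlet_def)

lemma nn_integral_dirichlet:
  assumes "1 \<le> n" and \<alpha>: "\<And>i. i \<in> {1..n} \<Longrightarrow> 0 < \<alpha> i"
    and f [measurable]: "f \<in> borel_measurable (\<Pi>\<^sub>M i\<in>{1..n}. borel)"
  shows "(\<integral>\<^sup>+x. f x \<partial>dirichlet n \<alpha>) = ennreal (Gamma (\<Sum>i\<in>{1..n}. \<alpha> i)) *
    (\<integral>\<^sup>+x. ennreal (power_kernel (\<alpha> n) (1 - (\<Sum>i\<in>{1..<n}. x i)) * (\<Prod>i\<in>{1..<n}. power_kernel (\<alpha> i) (x i))) *
      f (simplex_point n x) \<partial>(\<Pi>\<^sub>M i\<in>{1..<n}. lborel))"
proof -
  note [measurable] = measurable_simplex_point[OF \<open>1 \<le> n\<close>]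
  have "0 < (\<Sum>i\<in>{1..n}. \<alpha> i)"
    using assms by (intro sum_pos) auto
  then have G: "0 \<le> Gamma (\<Sum>i\<in>{1..n}. \<alpha> i)"
    by (simp add: less_imp_le)
  show ?thesis
    unfolding dirichlet_def dirichlet_density_simplex_point[OF \<open>1 \<le> n\<close>]
    by (subst nn_integral_distr, measurable, subst nn_integral_density, measurable)
      (simp add: G ennreal_mult' mult.assoc nn_integral_cmult del: One_nat_def)
qed

text \<open>Integrating out all coordinates except l convolves their kernels into a single one,
  whose parameter is the sum of theirs. With at least two coordinates that sum is positive.\<close>

lemma dirichlet_marginal:
  assumes n: "2 \<le> n" and \<alpha>: "\<And>i. i \<in> {1..n} \<Longrightarrow> 0 < \<alpha> i" and l: "l \<in> {1..n}"
  shows "distr (dirichlet n \<alpha>) borel (\<lambda>x. x l) = beta_distribution (\<alpha> l) ((\<Sum>i\<in>{1..n}. \<alpha> i) - \<alpha> l)"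
proof -
  interpret product_sigma_finite "\<lambda>_. lborel :: real measure"
    by (rule product_sigma_finite_lborel)
  define b where "b = (\<Sum>i\<in>{1..n}. \<alpha> i) - \<alpha> l"
  have b_eq: "b = (\<Sum>i\<in>{1..n} - {l}. \<alpha> i)"
    using l by (simp add: b_def sum_diff1)
  have b: "0 < b"
    unfolding b_eq using n l \<alpha>
    by (intro sum_pos) (auto simp: subset_singleton_iff dest!: equalityD1 subset_singletonD)
  let ?K = "\<lambda>J (x :: nat \<Rightarrow> real). \<Prod>j\<in>J. power_kernel (\<alpha> j) (x j)"
  have nn: "0 \<le> ?K J x" if "J \<subseteq> {1..n}" for J x
    using \<alpha> that by (intro prod_nonneg ballI power_kernel_nonneg) auto
  \<comment> \<open>The unnormalised density of coordinate l, tested against f; the Gamma constant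
    is restored at the end.\<close>
  have main: "(\<integral>\<^sup>+x. ennreal (power_kernel (\<alpha> n) (1 - (\<Sum>i\<in>{1..<n}. x i)) * ?K {1..<n} x) *
      f (simplex_point n x l) \<partial>(\<Pi>\<^sub>M i\<in>{1..<n}. lborel))
    = (\<integral>\<^sup>+t. ennreal (power_kernel (\<alpha> l) t * power_kernel b (1 - t)) * f t \<partial>lborel)"
    if f [measurable]: "f \<in> borel_measurable borel" for f :: "real \<Rightarrow> ennreal"
  proof (cases "l = n")
    case False
    \<comment> \<open>Here coordinate l is itself an integration variable, kept as t. The dependent
      coordinate n supplies the initial kernel of the iterated convolution over J.\<close>
    define J where "J = {1..<n} - {l}"
    have J: "finite J" "l \<notin> J" "{1..<n} = insert l J" "J \<subseteq> {1..n}"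
      using l False by (auto simp: J_def)
    have "{1..n} - {l} = insert n J" "n \<notin> J"
      using l False by (auto simp: J_def)
    then have bJ: "b = \<alpha> n + (\<Sum>j\<in>J. \<alpha> j)"
      using J by (simp add: b_eq)
    have upd: "(\<Sum>j\<in>J. (x(l := y)) j) = (\<Sum>j\<in>J. x j)" "?K J (x(l := y)) = ?K J x" for x and y :: real
      using J by (auto intro!: sum.cong prod.cong)
    have "(\<integral>\<^sup>+x. ennreal (power_kernel (\<alpha> n) (1 - (\<Sum>i\<in>{1..<n}. x i)) * ?K {1..<n} x) *
      f (simplex_point n x l) \<partial>(\<Pi>\<^sub>M i\<in>{1..<n}. lborel))
      = (\<integral>\<^sup>+x. ennreal (power_kernel (\<alpha> n) (1 - (x l + (\<Sum>j\<in>J. x j))) * (power_kernel (\<alpha> l) (x l) * ?K J x)) *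
          f (x l) \<partial>(\<Pi>\<^sub>M i\<in>insert l J. lborel))"
      using J False by (simp add: simplex_point_def)
    also have "\<dots> = (\<integral>\<^sup>+t. \<integral>\<^sup>+x. ennreal (power_kernel (\<alpha> n) (1 - (t + (\<Sum>j\<in>J. x j))) *
        (power_kernel (\<alpha> l) t * ?K J x)) * f t \<partial>(\<Pi>\<^sub>M j\<in>J. lborel) \<partial>lborel)"
      using J by (subst product_nn_integral_insert_rev) (simp_all only: upd fun_upd_same, measurable)
    also have "\<dots> = (\<integral>\<^sup>+t. ennreal (power_kernel (\<alpha> l) t * power_kernel b (1 - t)) * f t \<partial>lborel)"
    proof (rule nn_integral_cong)
      fix t :: real
      have "(\<integral>\<^sup>+x. ennreal (power_kernel (\<alpha> n) (1 - (t + (\<Sum>j\<in>J. x j))) *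
        (power_kernel (\<alpha> l) t * ?K J x)) * f t \<partial>(\<Pi>\<^sub>M j\<in>J. lborel))
        = (\<integral>\<^sup>+x. ennreal (power_kernel (\<alpha> l) t) * f t *
            ennreal (power_kernel (\<alpha> n) (1 - t - (\<Sum>j\<in>J. x j)) * ?K J x) \<partial>(\<Pi>\<^sub>M j\<in>J. lborel))"
        using l \<alpha> by (intro nn_integral_cong)
          (simp add: power_kernel_nonneg ennreal_mult'[symmetric] mult_ac diff_diff_eq)
      also have "\<dots> = ennreal (power_kernel (\<alpha> l) t) * f t * ennreal (power_kernel b (1 - t))"
        unfolding bJ using J \<alpha> l n
        by (subst nn_integral_cmult, measurable, subst nn_integral_power_kernel_PiM) auto
      finally show "(\<integral>\<^sup>+x. ennreal (power_kernel (\<alpha> n) (1 - (t + (\<Sum>j\<in>J. x j))) *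
        (power_kernel (\<alpha> l) t * ?K J x)) * f t \<partial>(\<Pi>\<^sub>M j\<in>J. lborel))
        = ennreal (power_kernel (\<alpha> l) t * power_kernel b (1 - t)) * f t"
        using b by (simp add: power_kernel_nonneg ennreal_mult'' mult_ac)
    qed
    finally show ?thesis .
  next
    case True
    \<comment> \<open>The last coordinate is determined by the others, so it replaces the first one as integration variable.\<close>
    define J where "J = {1..<n} - {1}"
    have J: "finite J" "1 \<notin> J" "{1..<n} = insert 1 J" "J \<subseteq> {1..n}"
      using n by (auto simp: J_def)
    have "{1..n} - {l} = insert 1 J"
      using n True by (auto simp: J_def)
    then have bJ: "b = \<alpha> 1 + (\<Sum>j\<in>J. \<alpha> j)"
      using J by (simp add: b_eq)
    have upd: "(\<Sum>j\<in>J. (x(1 := y)) j) = (\<Sum>j\<in>J. x j)" "?K J (x(1 := y)) = ?K J x" for x and y :: real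
      using J by (auto intro!: sum.cong prod.cong)
    interpret fin: finite_product_sigma_finite "\<lambda>_. lborel :: real measure" J
      by standard (rule J)
    interpret pair_sigma_finite "\<Pi>\<^sub>M j\<in>J. (lborel :: real measure)" "lborel :: real measure" ..
    have "(\<integral>\<^sup>+x. ennreal (power_kernel (\<alpha> n) (1 - (\<Sum>i\<in>{1..<n}. x i)) * ?K {1..<n} x) *
      f (simplex_point n x l) \<partial>(\<Pi>\<^sub>M i\<in>{1..<n}. lborel))
      = (\<integral>\<^sup>+x. ennreal (power_kernel (\<alpha> l) (1 - (x 1 + (\<Sum>j\<in>J. x j))) * (power_kernel (\<alpha> 1) (x 1) * ?K J x)) *
          f (1 - (x 1 + (\<Sum>j\<in>J. x j))) \<partial>(\<Pi>\<^sub>M i\<in>insert 1 J. lborel))"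
      using J(1,2) unfolding J(3) by (simp add: simplex_point_def True J(3)[unfolded One_nat_def])
    also have "\<dots> = (\<integral>\<^sup>+x. \<integral>\<^sup>+y. ennreal (power_kernel (\<alpha> l) (1 - (y + (\<Sum>j\<in>J. x j))) *
        (power_kernel (\<alpha> 1) y * ?K J x)) * f (1 - (y + (\<Sum>j\<in>J. x j))) \<partial>lborel \<partial>(\<Pi>\<^sub>M j\<in>J. lborel))"
      using J by (subst product_nn_integral_insert) (simp_all only: upd fun_upd_same, measurable)
    \<comment> \<open>Reflection of y about the remaining mass: t is now the last coordinate and
      coordinate 1 the dependent one.\<close>
    also have "\<dots> = (\<integral>\<^sup>+x. \<integral>\<^sup>+t. ennreal (power_kernel (\<alpha> l) t *
        (power_kernel (\<alpha> 1) (1 - t - (\<Sum>j\<in>J. x j)) * ?K J x)) * f t \<partial>lborel \<partial>(\<Pi>\<^sub>M j\<in>J. lborel))"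
    proof (rule nn_integral_cong)
      fix x :: "nat \<Rightarrow> real"
      show "(\<integral>\<^sup>+y. ennreal (power_kernel (\<alpha> l) (1 - (y + (\<Sum>j\<in>J. x j))) *
          (power_kernel (\<alpha> 1) y * ?K J x)) * f (1 - (y + (\<Sum>j\<in>J. x j))) \<partial>lborel)
        = (\<integral>\<^sup>+t. ennreal (power_kernel (\<alpha> l) t *
          (power_kernel (\<alpha> 1) (1 - t - (\<Sum>j\<in>J. x j)) * ?K J x)) * f t \<partial>lborel)"
        by (subst nn_integral_real_affine[where c="-1" and t="1 - (\<Sum>j\<in>J. x j)"]) (simp_all add: algebra_simps)
    qed
    also have "\<dots> = (\<integral>\<^sup>+t. \<integral>\<^sup>+x. ennreal (power_kernel (\<alpha> l) t *
        (power_kernel (\<alpha> 1) (1 - t - (\<Sum>j\<in>J. x j)) * ?K J x)) * f t \<partial>(\<Pi>\<^sub>M j\<in>J. lborel) \<partial>lborel)"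
      by (rule Fubini'[symmetric]) measurable
    also have "\<dots> = (\<integral>\<^sup>+t. ennreal (power_kernel (\<alpha> l) t * power_kernel b (1 - t)) * f t \<partial>lborel)"
    proof (rule nn_integral_cong)
      fix t :: real
      have "(\<integral>\<^sup>+x. ennreal (power_kernel (\<alpha> l) t *
        (power_kernel (\<alpha> 1) (1 - t - (\<Sum>j\<in>J. x j)) * ?K J x)) * f t \<partial>(\<Pi>\<^sub>M j\<in>J. lborel))
        = (\<integral>\<^sup>+x. ennreal (power_kernel (\<alpha> l) t) * f t *
            ennreal (power_kernel (\<alpha> 1) (1 - t - (\<Sum>j\<in>J. x j)) * ?K J x) \<partial>(\<Pi>\<^sub>M j\<in>J. lborel))"
        using l \<alpha> by (intro nn_integral_cong)
          (simp add: power_kernel_nonneg ennreal_mult' mult_ac)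
      also have "\<dots> = ennreal (power_kernel (\<alpha> l) t) * f t * ennreal (power_kernel b (1 - t))"
        unfolding bJ using J \<alpha> l n
        by (subst nn_integral_cmult, measurable, subst nn_integral_power_kernel_PiM) auto
      finally show "(\<integral>\<^sup>+x. ennreal (power_kernel (\<alpha> l) t *
        (power_kernel (\<alpha> 1) (1 - t - (\<Sum>j\<in>J. x j)) * ?K J x)) * f t \<partial>(\<Pi>\<^sub>M j\<in>J. lborel))
        = ennreal (power_kernel (\<alpha> l) t * power_kernel b (1 - t)) * f t"
        using b by (simp add: power_kernel_nonneg ennreal_mult'' mult_ac)
    qed
    finally show ?thesis .
  qed
  have [measurable]: "(\<lambda>x. x l) \<in> borel_measurable (\<Pi>\<^sub>M i\<in>{1..n}. (borel :: real measure))"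
    using l by measurable
  have "0 < \<alpha> l" using l \<alpha> by simp
  show ?thesis
    unfolding b_def[symmetric]
  proof (rule measure_eqI)
    fix A :: "real set" assume "A \<in> sets (distr (dirichlet n \<alpha>) borel (\<lambda>x. x l))"
    then have A [measurable]: "A \<in> sets borel" by simp
    have "emeasure (distr (dirichlet n \<alpha>) borel (\<lambda>x. x l)) A = (\<integral>\<^sup>+x. indicator A (x l) \<partial>dirichlet n \<alpha>)"
      by (subst nn_integral_indicator[symmetric], simp, subst nn_integral_distr) simp_all
    also have "\<dots> = ennreal (Gamma (\<Sum>i\<in>{1..n}. \<alpha> i)) *
      (\<integral>\<^sup>+t. ennreal (power_kernel (\<alpha> l) t * power_kernel b (1 - t)) * indicator A t \<partial>lborel)"
      using n \<alpha> by (subst nn_integral_dirichlet) (simp_all add: main del: One_nat_def)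
    also have "(\<Sum>i\<in>{1..n}. \<alpha> i) = \<alpha> l + b"
      by (simp add: b_def)
    also have "ennreal (Gamma (\<alpha> l + b)) *
      (\<integral>\<^sup>+t. ennreal (power_kernel (\<alpha> l) t * power_kernel b (1 - t)) * indicator A t \<partial>lborel)
      = emeasure (beta_distribution (\<alpha> l) b) A"
      using \<open>0 < \<alpha> l\<close> b unfolding beta_distribution_eq_power_kernel[OF \<open>0 < \<alpha> l\<close> b]
      by (subst nn_integral_cmult[symmetric])
        (simp_all add: emeasure_density ennreal_mult_left_assoc less_imp_le)
    finally show "emeasure (distr (dirichlet n \<alpha>) borel (\<lambda>x. x l)) A = emeasure (beta_distribution (\<alpha> l) b) A" .
  qed simp
qed

section \<open>Beta prime laws: odds, multiplication by Dirichlet coordinates, half-Cauchy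
  squares\<close>

lemma nn_integral_beta_prime:
  assumes "0 < a" "0 < b" and [measurable]: "f \<in> borel_measurable borel"
  shows "(\<integral>\<^sup>+x. f x \<partial>beta_prime_distribution a b)
    = (\<integral>\<^sup>+s. \<integral>\<^sup>+y. f (y / s) \<partial>gamma_distribution a \<partial>gamma_distribution b)"
proof -
  interpret A: prob_space "gamma_distribution a" by (rule prob_space_gamma_distribution) fact
  interpret B: prob_space "gamma_distribution b" by (rule prob_space_gamma_distribution) fact
  interpret pair_prob_space "gamma_distribution a" "gamma_distribution b" ..
  show ?thesis
    unfolding beta_prime_distribution_def
    by (subst nn_integral_distr) (simp_all add: nn_integral_snd[symmetric] split_beta')
qed

text \<open>The odds w / (1 - w) equal w t / ((1 - w) t) for an auxiliary Gamma(a + b) variable t,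
  and these two products are independent Gamma variables.\<close>

lemma beta_odds_distribution:
  assumes ab: "0 < a" "0 < b"
  shows "distr (beta_distribution a b) borel (\<lambda>r. r / (1 - r)) = beta_prime_distribution a b"
proof (rule measure_eqI)
  fix A :: "real set" assume "A \<in> sets (distr (beta_distribution a b) borel (\<lambda>r. r / (1 - r)))"
  then have A [measurable]: "A \<in> sets borel" by simp
  interpret A: prob_space "gamma_distribution a" by (rule prob_space_gamma_distribution) fact
  interpret B: prob_space "gamma_distribution b" by (rule prob_space_gamma_distribution) fact
  interpret AB: prob_space "gamma_distribution (a + b)"
    using ab by (intro prob_space_gamma_distribution) simp
  interpret pair_prob_space "gamma_distribution a" "gamma_distribution b" ..
  let ?f = "indicator A :: real \<Rightarrow> ennreal"
  have "emeasure (distr (beta_distribution a b) borel (\<lambda>r. r / (1 - r))) A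
    = (\<integral>\<^sup>+w. ?f (w / (1 - w)) \<partial>beta_distribution a b)"
    by (subst nn_integral_indicator[symmetric], simp, subst nn_integral_distr) simp_all
  also have "\<dots> = (\<integral>\<^sup>+w. \<integral>\<^sup>+t. ?f (w * t / ((1 - w) * t)) \<partial>gamma_distribution (a + b) \<partial>beta_distribution a b)"
  proof (rule nn_integral_cong)
    fix w :: real
    \<comment> \<open>The factor t cancels except at 0, where the Gamma density vanishes.\<close>
    have "(\<integral>\<^sup>+t. ?f (w * t / ((1 - w) * t)) \<partial>gamma_distribution (a + b))
      = (\<integral>\<^sup>+t. ?f (w / (1 - w)) \<partial>gamma_distribution (a + b))"
      by (subst nn_integral_gamma_distribution, measurable, subst nn_integral_gamma_distribution, measurable,
          rule nn_integral_cong, auto simp: power_kernel_def)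
    also have "\<dots> = ?f (w / (1 - w))"
      using AB.emeasure_space_1 by simp
    finally show "?f (w / (1 - w)) = (\<integral>\<^sup>+t. ?f (w * t / ((1 - w) * t)) \<partial>gamma_distribution (a + b))" ..
  qed
  also have "\<dots> = (\<integral>\<^sup>+y. \<integral>\<^sup>+s. ?f (y / s) \<partial>gamma_distribution b \<partial>gamma_distribution a)"
    using ab by (intro nn_integral_beta_gamma) auto
  also have "\<dots> = (\<integral>\<^sup>+s. \<integral>\<^sup>+y. ?f (y / s) \<partial>gamma_distribution a \<partial>gamma_distribution b)"
    by (rule Fubini'[symmetric]) measurable
  also have "\<dots> = emeasure (beta_prime_distribution a b) A"
    using ab by (simp add: nn_integral_beta_prime[symmetric])
  finally show "emeasure (distr (beta_distribution a b) borel (\<lambda>r. r / (1 - r))) A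
    = emeasure (beta_prime_distribution a b) A" .
qed simp

text \<open>The total mass is read off the first marginal, a Beta law. Dimension 1 is separate,
  because the second Beta parameter would be 0 there.\<close>

lemma prob_space_dirichlet:
  assumes "1 \<le> n" and \<alpha>: "\<And>i. i \<in> {1..n} \<Longrightarrow> 0 < \<alpha> i"
  shows "prob_space (dirichlet n \<alpha>)"
proof (cases "n = 1")
  case True
  then show ?thesis
    unfolding True using assms by (subst dirichlet_1) (auto intro!: prob_space_return simp: space_PiM)
next
  case False
  then have n: "2 \<le> n" using assms by simp
  have [measurable]: "(\<lambda>x. x 1) \<in> borel_measurable (\<Pi>\<^sub>M i\<in>{1..n}. (borel :: real measure))"
    using assms by (intro measurable_component_singleton) simp
  have b: "0 < (\<Sum>i\<in>{1..n}. \<alpha> i) - \<alpha> 1"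
  proof -
    have "{1..n} - {1} \<noteq> {}" using n by (auto simp: set_eq_iff intro!: exI[of _ 2])
    then have "0 < (\<Sum>i\<in>{1..n} - {1}. \<alpha> i)" using \<alpha> by (intro sum_pos) auto
    then show ?thesis using n by (simp add: sum_diff1)
  qed
  interpret B: prob_space "beta_distribution (\<alpha> 1) ((\<Sum>i\<in>{1..n}. \<alpha> i) - \<alpha> 1)"
    using n \<alpha> b by (intro prob_space_beta_distribution) auto
  have "emeasure (distr (dirichlet n \<alpha>) borel (\<lambda>x. x 1)) UNIV = 1"
    using B.emeasure_space_1 n \<alpha> by (subst dirichlet_marginal) auto
  then show ?thesis
    by (intro prob_spaceI) (simp add: emeasure_distr del: One_nat_def)
qed

text \<open>Coordinate l is Beta distributed, and its product with the Gamma numerator of the ratio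
  is a Gamma variable with parameter \<open>\<alpha> l\<close>; the denominator is unchanged. In
  dimension 1 the factor is 1 and the sum is already \<open>\<alpha> l\<close>. This is the step
  that lowers the first parameter, for groups and then within a group.\<close>

lemma nn_integral_dirichlet_beta_prime:
  assumes n: "1 \<le> n" and \<alpha>: "\<And>i. i \<in> {1..n} \<Longrightarrow> 0 < \<alpha> i" and l: "l \<in> {1..n}" and c: "0 < c"
    and f [measurable]: "f \<in> borel_measurable borel"
  shows "(\<integral>\<^sup>+x. \<integral>\<^sup>+t. f (x l * t) \<partial>beta_prime_distribution (\<Sum>i\<in>{1..n}. \<alpha> i) c \<partial>dirichlet n \<alpha>)
    = (\<integral>\<^sup>+t. f t \<partial>beta_prime_distribution (\<alpha> l) c)"
proof -
  define S where "S = (\<Sum>i\<in>{1..n}. \<alpha> i)"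
  have S: "0 < S"
    unfolding S_def using n \<alpha> by (intro sum_pos) auto
  interpret Bp: prob_space "beta_prime_distribution S c"
    using S c by (rule prob_space_beta_prime_distribution)
  have [measurable]: "(\<lambda>x. x l) \<in> borel_measurable (\<Pi>\<^sub>M i\<in>{1..n}. (borel :: real measure))"
    using l by (intro measurable_component_singleton)
  show ?thesis
    unfolding S_def[symmetric]
  proof (cases "n = 1")
    case True
    then have "l = 1" "S = \<alpha> l" using l by (auto simp: S_def)
    have "dirichlet n \<alpha> = return (\<Pi>\<^sub>M i\<in>{1..n}. borel) (\<lambda>i\<in>{1..1}. 1)"
      unfolding True using \<alpha> n by (intro dirichlet_1) simp
    then have "(\<integral>\<^sup>+x. \<integral>\<^sup>+t. f (x l * t) \<partial>beta_prime_distribution S c \<partial>dirichlet n \<alpha>)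
      = (\<integral>\<^sup>+t. f ((\<lambda>i\<in>{1..1}. 1) l * t) \<partial>beta_prime_distribution S c)"
      by (simp only:, subst nn_integral_return) (simp add: space_PiM True, measurable)
    also have "\<dots> = (\<integral>\<^sup>+t. f t \<partial>beta_prime_distribution (\<alpha> l) c)"
      unfolding \<open>S = \<alpha> l\<close> by (simp add: \<open>l = 1\<close>)
    finally show "(\<integral>\<^sup>+x. \<integral>\<^sup>+t. f (x l * t) \<partial>beta_prime_distribution S c \<partial>dirichlet n \<alpha>)
      = (\<integral>\<^sup>+t. f t \<partial>beta_prime_distribution (\<alpha> l) c)" .
  next
    case False
    then have n2: "2 \<le> n" using n by simp
    define b where "b = S - \<alpha> l"
    have b: "0 < b"
    proof -
      have "(if l = 1 then 2 else 1) \<in> {1..n} - {l}" using n2 by auto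
      then have "{1..n} - {l} \<noteq> {}" by blast
      then have "0 < (\<Sum>i\<in>{1..n} - {l}. \<alpha> i)" using \<alpha> by (intro sum_pos) auto
      then show ?thesis using l by (simp add: sum_diff1 b_def S_def)
    qed
    have a: "0 < \<alpha> l" using \<alpha> l .
    interpret Be: prob_space "beta_distribution (\<alpha> l) b" using a b by (rule prob_space_beta_distribution)
    interpret Ga: prob_space "gamma_distribution S" using S by (rule prob_space_gamma_distribution)
    interpret Gb: prob_space "gamma_distribution b" using b by (rule prob_space_gamma_distribution)
    interpret Gc: prob_space "gamma_distribution c" using c by (rule prob_space_gamma_distribution)
    interpret pair_prob_space "beta_distribution (\<alpha> l) b" "gamma_distribution c" ..
    have "(\<integral>\<^sup>+x. \<integral>\<^sup>+t. f (x l * t) \<partial>beta_prime_distribution S c \<partial>dirichlet n \<alpha>)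
      = (\<integral>\<^sup>+w. \<integral>\<^sup>+t. f (w * t) \<partial>beta_prime_distribution S c \<partial>distr (dirichlet n \<alpha>) borel (\<lambda>x. x l))"
      by (subst nn_integral_distr) simp_all
    also have "\<dots> = (\<integral>\<^sup>+w. \<integral>\<^sup>+t. f (w * t) \<partial>beta_prime_distribution S c \<partial>beta_distribution (\<alpha> l) b)"
      using n2 \<alpha> l by (subst dirichlet_marginal) (auto simp: b_def S_def)
    also have "\<dots> = (\<integral>\<^sup>+w. \<integral>\<^sup>+s. \<integral>\<^sup>+y. f (w * (y / s)) \<partial>gamma_distribution S \<partial>gamma_distribution c \<partial>beta_distribution (\<alpha> l) b)"
      using S c by (simp add: nn_integral_beta_prime)
    \<comment> \<open>The denominator s moves outside, so that w and y can be merged for fixed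
      s.\<close>
    also have "\<dots> = (\<integral>\<^sup>+s. \<integral>\<^sup>+w. \<integral>\<^sup>+y. f (w * (y / s)) \<partial>gamma_distribution S \<partial>beta_distribution (\<alpha> l) b \<partial>gamma_distribution c)"
      by (rule Fubini'[symmetric]) measurable
    also have "\<dots> = (\<integral>\<^sup>+s. \<integral>\<^sup>+y. f (y / s) \<partial>gamma_distribution (\<alpha> l) \<partial>gamma_distribution c)"
    proof (rule nn_integral_cong)
      fix s :: real
      have "(\<integral>\<^sup>+w. \<integral>\<^sup>+y. f (w * (y / s)) \<partial>gamma_distribution S \<partial>beta_distribution (\<alpha> l) b)
        = (\<integral>\<^sup>+w. \<integral>\<^sup>+y. f (w * y / s) \<partial>gamma_distribution (\<alpha> l + b) \<partial>beta_distribution (\<alpha> l) b)"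
        by (simp add: b_def)
      \<comment> \<open>Here r stands for the complementary product (1 - w) y, which integrates to
        1.\<close>
      also have "\<dots> = (\<integral>\<^sup>+y. \<integral>\<^sup>+r. f (y / s) \<partial>gamma_distribution b \<partial>gamma_distribution (\<alpha> l))"
        using a b by (rule nn_integral_beta_gamma) measurable
      also have "\<dots> = (\<integral>\<^sup>+y. f (y / s) \<partial>gamma_distribution (\<alpha> l))"
        using Gb.emeasure_space_1 by simp
      finally show "(\<integral>\<^sup>+w. \<integral>\<^sup>+y. f (w * (y / s)) \<partial>gamma_distribution S \<partial>beta_distribution (\<alpha> l) b)
        = (\<integral>\<^sup>+y. f (y / s) \<partial>gamma_distribution (\<alpha> l))" .
    qed
    also have "\<dots> = (\<integral>\<^sup>+t. f t \<partial>beta_prime_distribution (\<alpha> l) c)"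
      using a c by (simp add: nn_integral_beta_prime)
    finally show "(\<integral>\<^sup>+x. \<integral>\<^sup>+t. f (x l * t) \<partial>beta_prime_distribution S c \<partial>dirichlet n \<alpha>)
      = (\<integral>\<^sup>+t. f t \<partial>beta_prime_distribution (\<alpha> l) c)" .
  qed
qed

text \<open>Put x = y / s in the ratio of two Gamma(1/2) variables. The integral over s is then the
  mass of an exponential law with rate 1 + x, which leaves the density 1 / (pi sqrt x (1 + x));
  replacing x by its square root gives the half-Cauchy density.\<close>

lemma half_cauchy_square_distribution:
  "distr half_cauchy borel (\<lambda>x. x\<^sup>2) = beta_prime_distribution (1 / 2) (1 / 2)"
proof (rule measure_eqI)
  fix A :: "real set" assume "A \<in> sets (distr half_cauchy borel (\<lambda>x. x\<^sup>2))"
  then have A [measurable]: "A \<in> sets borel" by simp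
  \<comment> \<open>The Beta prime density for parameters 1/2, 1/2, restricted to A.\<close>
  define f where "f x = indicator A x * (if 0 < x then 1 / (pi * sqrt x * (1 + x)) else 0)" for x :: real
  have [measurable]: "f \<in> borel_measurable borel"
    unfolding f_def by measurable
  have f: "0 \<le> f x" for x
    by (simp add: f_def)
  have k: "power_kernel (1 / 2) x = (if 0 < x then 1 / (sqrt x * sqrt pi) else 0)" for x
    by (simp add: power_kernel_def Gamma_one_half_real powr_minus powr_half_sqrt divide_simps)
  have "emeasure (beta_prime_distribution (1 / 2) (1 / 2)) A
    = (\<integral>\<^sup>+s. \<integral>\<^sup>+y. indicator A (y / s) \<partial>gamma_distribution (1 / 2) \<partial>gamma_distribution (1 / 2))"
    by (simp add: nn_integral_beta_prime[symmetric])
  also have "\<dots> = (\<integral>\<^sup>+s. ennreal (power_kernel (1 / 2) s * exp (- s)) *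
      (\<integral>\<^sup>+y. ennreal (power_kernel (1 / 2) y * exp (- y)) * indicator A (y / s) \<partial>lborel) \<partial>lborel)"
    by (simp add: nn_integral_gamma_distribution)
  also have "\<dots> = (\<integral>\<^sup>+s. \<integral>\<^sup>+x. ennreal (f x * ((1 + x) * exp (- s * (1 + x)) * indicator {0<..} s)) \<partial>lborel \<partial>lborel)"
  proof (rule nn_integral_cong)
    fix s :: real
    show "ennreal (power_kernel (1 / 2) s * exp (- s)) *
      (\<integral>\<^sup>+y. ennreal (power_kernel (1 / 2) y * exp (- y)) * indicator A (y / s) \<partial>lborel)
      = (\<integral>\<^sup>+x. ennreal (f x * ((1 + x) * exp (- s * (1 + x)) * indicator {0<..} s)) \<partial>lborel)"
    proof (cases "0 < s")
      case False
      then show ?thesis by (simp add: power_kernel_def)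
    next
      case True
      \<comment> \<open>The Jacobian s cancels the two factors 1 / sqrt s of the kernels, so s
        survives only in the exponential.\<close>
      have e: "power_kernel (1 / 2) s * exp (- s) * (s * (power_kernel (1 / 2) (s * x) * exp (- (s * x)) * indicator A x))
        = f x * ((1 + x) * exp (- s * (1 + x)))" for x
      proof (cases "0 < x")
        case x: True
        have r: "sqrt s * sqrt s = s" "sqrt pi * sqrt pi = pi" using True by simp_all
        have E: "exp (- s) * exp (- (s * x)) = exp (- s * (1 + x))"
          by (simp add: exp_add[symmetric] algebra_simps)
        have R: "power_kernel (1 / 2) s * s * power_kernel (1 / 2) (s * x) = 1 / (pi * sqrt x)"
        proof -
          have "sqrt s * sqrt pi * (sqrt (s * x) * sqrt pi) = (sqrt s * sqrt s) * (sqrt pi * sqrt pi) * sqrt x"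
            unfolding real_sqrt_mult by algebra
          then have d: "sqrt s * sqrt pi * (sqrt (s * x) * sqrt pi) = s * (pi * sqrt x)"
            unfolding r by simp
          have "power_kernel (1 / 2) s * s * power_kernel (1 / 2) (s * x)
            = 1 / (sqrt s * sqrt pi) * s * (1 / (sqrt (s * x) * sqrt pi))"
            using True x by (simp only: k if_True mult_pos_pos)
          also have "\<dots> = s / (sqrt s * sqrt pi * (sqrt (s * x) * sqrt pi))"
          proof -
            have "1 / p * u * (1 / q) = u / (p * q)" for p q u :: real by simp
            then show ?thesis .
          qed
          also have "\<dots> = 1 / (pi * sqrt x)"
            unfolding d using True by simp
          finally show ?thesis .
        qed
        have "power_kernel (1 / 2) s * exp (- s) * (s * (power_kernel (1 / 2) (s * x) * exp (- (s * x)) * indicator A x))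
          = (power_kernel (1 / 2) s * s * power_kernel (1 / 2) (s * x)) * (exp (- s) * exp (- (s * x))) * indicator A x"
          by (simp only: mult.assoc mult.left_commute mult.commute)
        also have "\<dots> = f x * ((1 + x) * exp (- s * (1 + x)))"
          unfolding R E using x by (simp add: f_def)
        finally show ?thesis .
      qed (use True in \<open>auto simp: f_def k zero_less_mult_iff\<close>)
      have "(\<integral>\<^sup>+y. ennreal (power_kernel (1 / 2) y * exp (- y)) * indicator A (y / s) \<partial>lborel)
        = ennreal \<bar>s\<bar> * (\<integral>\<^sup>+x. ennreal (power_kernel (1 / 2) (0 + s * x) * exp (- (0 + s * x))) * indicator A ((0 + s * x) / s) \<partial>lborel)"
        using True by (intro nn_integral_real_affine) auto
      also have "\<dots> = (\<integral>\<^sup>+x. ennreal (s * (power_kernel (1 / 2) (s * x) * exp (- (s * x)) * indicator A x)) \<partial>lborel)"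
        using True by (subst nn_integral_cmult[symmetric])
          (auto intro!: nn_integral_cong simp: ennreal_mult' power_kernel_nonneg split: split_indicator)
      finally have *: "(\<integral>\<^sup>+y. ennreal (power_kernel (1 / 2) y * exp (- y)) * indicator A (y / s) \<partial>lborel)
        = (\<integral>\<^sup>+x. ennreal (s * (power_kernel (1 / 2) (s * x) * exp (- (s * x)) * indicator A x)) \<partial>lborel)" .
      have "ennreal (power_kernel (1 / 2) s * exp (- s)) *
        (\<integral>\<^sup>+y. ennreal (power_kernel (1 / 2) y * exp (- y)) * indicator A (y / s) \<partial>lborel)
        = (\<integral>\<^sup>+x. ennreal (power_kernel (1 / 2) s * exp (- s) *
            (s * (power_kernel (1 / 2) (s * x) * exp (- (s * x)) * indicator A x))) \<partial>lborel)"
        unfolding * by (subst nn_integral_cmult[symmetric])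
          (simp_all add: ennreal_mult'[symmetric] power_kernel_nonneg)
      then show ?thesis
        unfolding e using True by simp
    qed
  qed
  also have "\<dots> = (\<integral>\<^sup>+x. \<integral>\<^sup>+s. ennreal (f x * ((1 + x) * exp (- s * (1 + x)) * indicator {0<..} s)) \<partial>lborel \<partial>lborel)"
    by (rule lborel_pair.Fubini') measurable
  also have "\<dots> = (\<integral>\<^sup>+x. ennreal (f x) * indicator {0..} x \<partial>lborel)"
  proof (rule nn_integral_cong)
    fix x :: real
    show "(\<integral>\<^sup>+s. ennreal (f x * ((1 + x) * exp (- s * (1 + x)) * indicator {0<..} s)) \<partial>lborel)
      = ennreal (f x) * indicator {0..} x"
    proof (cases "0 < x")
      case True
      interpret E: prob_space "density lborel (exponential_density (1 + x))"
        using True by (intro prob_space_exponential_density) simp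
      have "(\<integral>\<^sup>+s. ennreal (f x * ((1 + x) * exp (- s * (1 + x)) * indicator {0<..} s)) \<partial>lborel)
        = (\<integral>\<^sup>+s. ennreal (f x) * ennreal (exponential_density (1 + x) s) \<partial>lborel)"
      proof (rule nn_integral_cong_AE)
        \<comment> \<open>At \<open>s = 0\<close> the exponential density is positive but the
          indicator is 0; that point is a null set.\<close>
        show "AE s in lborel. ennreal (f x * ((1 + x) * exp (- s * (1 + x)) * indicator {0<..} s))
          = ennreal (f x) * ennreal (exponential_density (1 + x) s)"
          using AE_lborel_singleton[of 0]
        proof eventually_elim
          case (elim s)
          then show ?case
            using f True by (auto simp: exponential_density_def ennreal_mult'[symmetric] split: split_indicator)
        qed
      qed
      also have "\<dots> = ennreal (f x)"
        using E.emeasure_space_1 by (simp add: nn_integral_cmult emeasure_density)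
      finally show ?thesis using True by simp
    qed (simp add: f_def)
  qed
  also have "\<dots> = (\<integral>\<^sup>+x. ennreal (f (x\<^sup>2) * (2 * x)) * indicator {0..} x \<partial>lborel)"
    by (rule nn_integral_square_substitution) (auto simp: f)
  also have "\<dots> = (\<integral>\<^sup>+x. ennreal (if 0 < x then 2 / (pi * (1 + x\<^sup>2)) else 0) * indicator A (x\<^sup>2) \<partial>lborel)"
    by (auto intro!: nn_integral_cong simp: f_def split: split_indicator)
  also have "\<dots> = emeasure (distr half_cauchy borel (\<lambda>x. x\<^sup>2)) A"
    unfolding half_cauchy_def
    by (subst nn_integral_indicator[symmetric], simp, subst nn_integral_distr, simp, simp, subst nn_integral_density) simp_all
  finally show "emeasure (distr half_cauchy borel (\<lambda>x. x\<^sup>2)) A = emeasure (beta_prime_distribution (1 / 2) (1 / 2)) A" ..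
qed simp

text \<open>Push-forward under squaring preserves the total mass, which is 1 for the Beta prime
  law.\<close>

lemma prob_space_half_cauchy: "prob_space half_cauchy"
proof
  interpret prob_space "beta_prime_distribution (1 / 2) (1 / 2)"
    by (rule prob_space_beta_prime_distribution) auto
  show "emeasure half_cauchy (space half_cauchy) = 1"
    using emeasure_space_1 unfolding half_cauchy_square_distribution[symmetric] by (simp add: emeasure_distr)
qed

section \<open>The marginal of the Group-R2 prior\<close>

lemma prob_space_normal_distribution: "prob_space (normal_distribution \<mu> v)"
proof (cases "v = 0")
  case True
  then show ?thesis by (simp add: normal_distribution_def prob_space_return)
next
  case False
  \<comment> \<open>For \<open>v < 0\<close> the value \<open>sqrt v\<close> is negative, but the density depends only on its square.\<close>
  have "normal_density \<mu> (sqrt v) = normal_density \<mu> \<bar>sqrt v\<bar>"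
    by (simp add: normal_density_def fun_eq_iff)
  with False show ?thesis
    using prob_space_normal_density[of "\<bar>sqrt v\<bar>" \<mu>] by (simp add: normal_distribution_def)
qed

lemma measurable_normal_distribution [measurable]:
  "normal_distribution \<mu> \<in> measurable borel (prob_algebra borel)"
proof (rule measurable_prob_algebraI)
  show "prob_space (normal_distribution \<mu> v)" for v
    by (rule prob_space_normal_distribution)
  show "normal_distribution \<mu> \<in> measurable borel (subprob_algebra borel)"
  proof (rule measurable_subprob_algebra)
    show "subprob_space (normal_distribution \<mu> v)" for v
      by (intro prob_space_imp_subprob_space prob_space_normal_distribution)
    fix A :: "real set" assume [measurable]: "A \<in> sets borel"
    have "emeasure (normal_distribution \<mu> v) A = (if v = 0 then indicator A \<mu>
      else \<integral>\<^sup>+x. ennreal (normal_density \<mu> (sqrt v) x) * indicator A x \<partial>lborel)" for v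
      by (simp add: normal_distribution_def emeasure_density)
    moreover have "(\<lambda>v. if v = 0 then indicator A \<mu>
      else \<integral>\<^sup>+x. ennreal (normal_density \<mu> (sqrt v) x) * indicator A x \<partial>lborel) \<in> borel_measurable borel"
      unfolding normal_density_def by measurable
    ultimately show "(\<lambda>v. emeasure (normal_distribution \<mu> v) A) \<in> borel_measurable borel"
      by simp
  qed simp
qed

text \<open>It suffices to test on boxes, an intersection-stable generator. The mass of a box is a
  finite product of measurable coordinate masses.\<close>

lemma measurable_PiM_kernel:
  assumes I: "finite I" and K: "\<And>i. i \<in> I \<Longrightarrow> K i \<in> measurable M (prob_algebra (N i))"
  shows "(\<lambda>x. \<Pi>\<^sub>M i\<in>I. K i x) \<in> measurable M (prob_algebra (\<Pi>\<^sub>M i\<in>I. N i))"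
proof (rule measurable_prob_algebra_generated[OF sets_PiM Int_stable_prod_algebra prod_algebra_sets_into_space])
  fix x assume x: "x \<in> space M"
  have K': "prob_space (K i x)" "sets (K i x) = sets (N i)" if "i \<in> I" for i
    using measurable_space[OF K[OF that] x] by (auto simp: space_prob_algebra)
  then show "prob_space (\<Pi>\<^sub>M i\<in>I. K i x)" "sets (\<Pi>\<^sub>M i\<in>I. K i x) = sets (\<Pi>\<^sub>M i\<in>I. N i)"
    by (auto intro!: prob_space_PiM sets_PiM_cong)
next
  fix A assume "A \<in> prod_algebra I N"
  then obtain X where A: "A = (\<Pi>\<^sub>E i\<in>I. X i)" and X: "X \<in> (\<Pi> i\<in>I. sets (N i))"
    using I by (auto simp: prod_algebra_eq_finite)
  have "emeasure (\<Pi>\<^sub>M i\<in>I. K i x) A = (\<Prod>i\<in>I. emeasure (K i x) (X i))" if x: "x \<in> space M" for x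
  proof -
    \<comment> \<open>The locale \<open>product_sigma_finite\<close> asks for a measure at every
      index, so the family is extended by point masses outside I.\<close>
    define K' where "K' i = (if i \<in> I then K i x else return (count_space UNIV) undefined)" for i
    have K: "prob_space (K i x)" "sets (K i x) = sets (N i)" if "i \<in> I" for i
      using measurable_space[OF K[OF that] x] by (auto simp: space_prob_algebra)
    then have "prob_space (K' i)" for i
      by (auto simp: K'_def intro: prob_space_return)
    then interpret prob_space "K' i" for i .
    interpret product_sigma_finite K' ..
    have "(\<Pi>\<^sub>M i\<in>I. K i x) = (\<Pi>\<^sub>M i\<in>I. K' i)"
      by (intro PiM_cong) (auto simp: K'_def)
    then have "emeasure (\<Pi>\<^sub>M i\<in>I. K i x) A = (\<Prod>i\<in>I. emeasure (K' i) (X i))"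
      unfolding A using I X K by (simp, intro emeasure_PiM) (auto simp: K'_def Pi_iff)
    also have "\<dots> = (\<Prod>i\<in>I. emeasure (K i x) (X i))"
      by (intro prod.cong) (auto simp: K'_def)
    finally show ?thesis .
  qed
  moreover have "(\<lambda>x. \<Prod>i\<in>I. emeasure (K i x) (X i)) \<in> borel_measurable M"
  proof (rule borel_measurable_prod_ennreal)
    fix i assume i: "i \<in> I"
    then have "X i \<in> sets (N i)" using X by auto
    with K[OF i] show "(\<lambda>x. emeasure (K i x) (X i)) \<in> borel_measurable M"
      by (intro measurable_compose[OF measurable_prob_algebraD measurable_emeasure_subprob_algebra])
  qed
  ultimately show "(\<lambda>x. emeasure (\<Pi>\<^sub>M i\<in>I. K i x) A) \<in> borel_measurable M"
    by (simp cong: measurable_cong)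
qed

text \<open>The parameters telescope: G copies of \<open>a\<^sub>G\<close> sum to the first
  parameter of the law of \<open>\<tau>2\<close>, and \<open>p g\<close> copies of
  \<open>c g\<close> sum to \<open>a\<^sub>G\<close>. Hence the variance of each coefficient in
  group g is Beta prime with parameters \<open>c g\<close> and \<open>a\<^sub>2\<close>.\<close>

lemma group_R2_marginal_eq_bind:
  assumes p: "\<And>h. h \<in> {1..G} \<Longrightarrow> 1 \<le> p h" and a: "0 < a\<^sub>G" "0 < a\<^sub>2"
    and c: "\<And>h. h \<in> {1..G} \<Longrightarrow> c h = a\<^sub>G / real (p h)"
    and g: "g \<in> {1..G}" and l: "l \<in> {1..p g}"
  shows "group_R2_marginal G p a\<^sub>G a\<^sub>2 c g l
    = beta_prime_distribution (c g) a\<^sub>2 \<bind> normal_distribution 0"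
proof -
  have G: "1 \<le> G" using g by simp
  have c_pos: "0 < c h" if "h \<in> {1..G}" for h
    using c[OF that] p[OF that] a by simp
  define T where "T = beta_prime_distribution (real G * a\<^sub>G) a\<^sub>2"
  define \<Phi> where "\<Phi> = symmetric_dirichlet G a\<^sub>G"
  define D where "D h = symmetric_dirichlet (p h) (c h)" for h
  define \<Psi> where "\<Psi> = (\<Pi>\<^sub>M h\<in>{1..G}. D h)"
  define I where "I = (SIGMA h:{1..G}. {1..p h})"
  define q where "q = (\<lambda>(\<tau>2 :: real, \<phi> :: nat \<Rightarrow> real, \<psi> :: nat \<Rightarrow> nat \<Rightarrow> real) (h, k). \<psi> h k * \<phi> h * \<tau>2)"
  have T: "distr (beta_distribution (real G * a\<^sub>G) a\<^sub>2) borel (\<lambda>R2. R2 / (1 - R2)) = T"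
    unfolding T_def using G a by (intro beta_odds_distribution) auto
  interpret T: prob_space T
    unfolding T_def using G a by (intro prob_space_beta_prime_distribution) auto
  interpret \<Phi>: prob_space \<Phi>
    unfolding \<Phi>_def using G a by (intro prob_space_dirichlet) auto
  have D: "prob_space (D h)" if "h \<in> {1..G}" for h
    unfolding D_def using p[OF that] c_pos[OF that] by (intro prob_space_dirichlet) auto
  interpret \<Psi>: prob_space \<Psi>
    unfolding \<Psi>_def using D by (rule prob_space_PiM)
  interpret Dg: prob_space "D g" using D g .
  interpret \<Phi>\<Psi>: pair_prob_space \<Phi> \<Psi> ..
  interpret T\<Phi>: pair_prob_space T \<Phi> ..
  interpret TD: pair_prob_space "beta_prime_distribution a\<^sub>G a\<^sub>2" "D g" 
    using a by (intro pair_prob_space.intro pair_sigma_finite.intro prob_space_imp_sigma_finite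
      prob_space_beta_prime_distribution Dg.prob_space_axioms) auto
  let ?M = "T \<Otimes>\<^sub>M (\<Phi> \<Otimes>\<^sub>M \<Psi>)"
  have sets: "sets T = sets borel" "sets \<Phi> = sets (\<Pi>\<^sub>M i\<in>{1..G}. borel)"
    "sets (D h) = sets (\<Pi>\<^sub>M i\<in>{1..p h}. borel)" for h
    by (simp_all add: T_def \<Phi>_def D_def)
  note [measurable_cong] = sets
  have \<phi>_meas: "(\<lambda>\<phi>. \<phi> h) \<in> borel_measurable \<Phi>" if "h \<in> {1..G}" for h
    using that by measurable
  have D_meas: "(\<lambda>x. x k) \<in> borel_measurable (D h)" if "k \<in> {1..p h}" for h k
    using that by measurable
  have \<psi>_meas: "(\<lambda>\<psi>. \<psi> h k) \<in> borel_measurable \<Psi>" if "h \<in> {1..G}" "k \<in> {1..p h}" for h k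
  proof -
    have "(\<lambda>\<psi>. \<psi> h) \<in> measurable \<Psi> (D h)"
      unfolding \<Psi>_def using that(1) by (rule measurable_component_singleton)
    then show ?thesis
      using D_meas[OF that(2)] by (rule measurable_compose)
  qed
  have q_meas: "(\<lambda>\<omega>. q \<omega> i) \<in> borel_measurable ?M" if i_in: "i \<in> I" for i
  proof -
    obtain h k where i: "i = (h, k)" "h \<in> {1..G}" "k \<in> {1..p h}"
      using i_in unfolding I_def by blast
    note [measurable] = \<phi>_meas[OF i(2)] \<psi>_meas[OF i(2,3)]
    show ?thesis unfolding i q_def by (simp add: split_beta')
  qed
  have gl: "(g, l) \<in> I" using g l by (simp add: I_def)
  note q_gl = q_meas[OF gl]
  have ne: "space ?M \<noteq> {}"
    using T.not_empty \<Phi>.not_empty \<Psi>.not_empty by (simp add: space_pair_measure)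
  define K where "K \<omega> = (\<Pi>\<^sub>M i\<in>I. normal_distribution 0 (q \<omega> i))" for \<omega>
  have K: "K \<in> measurable ?M (subprob_algebra (\<Pi>\<^sub>M i\<in>I. borel))"
    unfolding K_def
    by (intro measurable_prob_algebraD measurable_PiM_kernel measurable_compose[OF q_meas measurable_normal_distribution])
      (simp_all add: I_def)
  have prior: "group_R2_prior G p a\<^sub>G a\<^sub>2 c = ?M \<bind> K"
    unfolding group_R2_prior_def T[symmetric] \<Phi>_def \<Psi>_def D_def
    by (rule arg_cong2[where f=bind, OF refl])
      (auto simp: fun_eq_iff K_def I_def q_def intro!: PiM_cong)
  have "group_R2_marginal G p a\<^sub>G a\<^sub>2 c g l = ?M \<bind> (\<lambda>\<omega>. distr (K \<omega>) borel (\<lambda>b. b (g, l)))"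
    unfolding group_R2_marginal_def prior using K ne gl by (intro distr_bind) auto
  \<comment> \<open>A coordinate of the conditional product law has its own factor as law, since all
    factors are probability measures.\<close>
  also have "(\<lambda>\<omega>. distr (K \<omega>) borel (\<lambda>b. b (g, l))) = (\<lambda>\<omega>. normal_distribution 0 (q \<omega> (g, l)))"
  proof
    fix \<omega>
    have "distr (K \<omega>) borel (\<lambda>b. b (g, l)) = distr (K \<omega>) (normal_distribution 0 (q \<omega> (g, l))) (\<lambda>b. b (g, l))"
      by (intro distr_cong) auto
    also have "\<dots> = normal_distribution 0 (q \<omega> (g, l))"
      unfolding K_def using gl by (intro distr_PiM_component prob_space_normal_distribution)
    finally show "distr (K \<omega>) borel (\<lambda>b. b (g, l)) = normal_distribution 0 (q \<omega> (g, l))" .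
  qed
  also have "?M \<bind> (\<lambda>\<omega>. normal_distribution 0 (q \<omega> (g, l))) = distr ?M borel (\<lambda>\<omega>. q \<omega> (g, l)) \<bind> normal_distribution 0"
    using ne by (intro bind_distr[symmetric, where K=borel] q_gl measurable_prob_algebraD measurable_normal_distribution)
  also have "distr ?M borel (\<lambda>\<omega>. q \<omega> (g, l)) = beta_prime_distribution (c g) a\<^sub>2"
  proof (rule measure_eqI)
    fix A :: "real set" assume "A \<in> sets (distr ?M borel (\<lambda>\<omega>. q \<omega> (g, l)))"
    then have A [measurable]: "A \<in> sets borel" by simp
    let ?f = "indicator A :: real \<Rightarrow> ennreal"
    note [measurable] = \<phi>_meas[OF g] \<psi>_meas[OF g l] D_meas[OF l] q_gl
    have "emeasure (distr ?M borel (\<lambda>\<omega>. q \<omega> (g, l))) A = (\<integral>\<^sup>+\<omega>. ?f (q \<omega> (g, l)) \<partial>?M)"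
      by (subst nn_integral_indicator[symmetric], simp, subst nn_integral_distr) simp_all
    also have "\<dots> = (\<integral>\<^sup>+\<tau>. \<integral>\<^sup>+\<phi>. \<integral>\<^sup>+\<psi>. ?f (\<psi> g l * \<phi> g * \<tau>) \<partial>\<Psi> \<partial>\<Phi> \<partial>T)"
      by (simp add: \<Phi>\<Psi>.P.nn_integral_fst[symmetric] \<Psi>.nn_integral_fst[symmetric] q_def split_beta')
    \<comment> \<open>The integrand depends on \<psi> only through its component g, whose law is
      \<open>D g\<close>.\<close>
    also have "\<dots> = (\<integral>\<^sup>+\<tau>. \<integral>\<^sup>+\<phi>. \<integral>\<^sup>+x. ?f (x l * (\<phi> g * \<tau>)) \<partial>D g \<partial>\<Phi> \<partial>T)"
    proof -
      have "(\<integral>\<^sup>+\<psi>. ?f (\<psi> g l * \<phi> g * \<tau>) \<partial>\<Psi>) = (\<integral>\<^sup>+x. ?f (x l * (\<phi> g * \<tau>)) \<partial>D g)" for \<phi> \<tau>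
      proof -
        have "(\<integral>\<^sup>+x. ?f (x l * (\<phi> g * \<tau>)) \<partial>D g) = (\<integral>\<^sup>+x. ?f (x l * (\<phi> g * \<tau>)) \<partial>distr \<Psi> (D g) (\<lambda>\<psi>. \<psi> g))"
          unfolding \<Psi>_def using D g by (subst distr_PiM_component) auto
        also have "\<dots> = (\<integral>\<^sup>+\<psi>. ?f (\<psi> g l * (\<phi> g * \<tau>)) \<partial>\<Psi>)"
          unfolding \<Psi>_def using g by (intro nn_integral_distr) simp_all
        finally show ?thesis by (simp add: mult.assoc)
      qed
      then show ?thesis by simp
    qed
    also have "\<dots> = (\<integral>\<^sup>+\<phi>. \<integral>\<^sup>+\<tau>. \<integral>\<^sup>+x. ?f (x l * (\<phi> g * \<tau>)) \<partial>D g \<partial>T \<partial>\<Phi>)"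
      by (rule T\<Phi>.Fubini'[symmetric]) measurable
    \<comment> \<open>The factor \<open>\<phi> g\<close> lowers the parameter from
      \<open>G * a\<^sub>G\<close> to \<open>a\<^sub>G\<close>. The test function is the whole inner
      integral over \<open>D g\<close>, as a function of the product.\<close>
    also have "\<dots> = (\<integral>\<^sup>+\<tau>. \<integral>\<^sup>+x. ?f (x l * \<tau>) \<partial>D g \<partial>beta_prime_distribution a\<^sub>G a\<^sub>2)"
      unfolding \<Phi>_def T_def
      using nn_integral_dirichlet_beta_prime[where f="\<lambda>t. \<integral>\<^sup>+x. ?f (x l * t) \<partial>D g" and n=G
          and \<alpha>="\<lambda>_. a\<^sub>G" and l=g and c=a\<^sub>2] G g a
      by simp
    also have "\<dots> = (\<integral>\<^sup>+x. \<integral>\<^sup>+\<tau>. ?f (x l * \<tau>) \<partial>beta_prime_distribution a\<^sub>G a\<^sub>2 \<partial>D g)"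
      by (rule TD.Fubini'[symmetric]) measurable
    \<comment> \<open>With the Dirichlet integral outermost, the same lemma lowers
      \<open>a\<^sub>G\<close> to \<open>c g\<close>.\<close>
    also have "\<dots> = (\<integral>\<^sup>+\<tau>. ?f \<tau> \<partial>beta_prime_distribution (c g) a\<^sub>2)"
    proof -
      have "(\<Sum>i\<in>{1..p g}. c g) = a\<^sub>G"
        using c[OF g] p[OF g] by simp
      then show ?thesis
        unfolding D_def
        using nn_integral_dirichlet_beta_prime[where f="?f" and n="p g"
          and \<alpha>="\<lambda>_. c g" and l=l and c=a\<^sub>2] p[OF g] c_pos[OF g] l a by simp
    qed
    finally show "emeasure (distr ?M borel (\<lambda>\<omega>. q \<omega> (g, l))) A = emeasure (beta_prime_distribution (c g) a\<^sub>2) A"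
      by simp
  qed simp
  finally show ?thesis .
qed

lemma horseshoe_prior_eq_bind:
  "horseshoe_prior = beta_prime_distribution (1 / 2) (1 / 2) \<bind> normal_distribution 0"
  unfolding half_cauchy_square_distribution[symmetric] horseshoe_prior_def
  by (rule bind_distr[symmetric, where K=borel]) (auto intro: measurable_prob_algebraD)

section \<open>Bounded influence of the horseshoe prior\<close>

lemma normal_density_sqrt:
  "0 < v \<Longrightarrow> normal_density \<mu> (sqrt v) x = exp (- ((x - \<mu>)\<^sup>2 / (2 * v))) / sqrt (2 * pi * v)"
  by (simp add: normal_density_def)

text \<open>Completing the square in b factors the joint density into the marginal density of y and
  the posterior density of b.\<close>

lemma normal_density_times_normal_density:
  assumes v: "0 < v"
  shows "normal_density 0 (sqrt v) b * normal_density b 1 y =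
    normal_density 0 (sqrt (1 + v)) y * normal_density (v * y / (1 + v)) (sqrt (v / (1 + v))) b"
proof -
  define r where "r = 1 + v"
  have r: "0 < r" using v by (simp add: r_def)
  \<comment> \<open>The equality of the two exponents with the common denominator
    \<open>2 * v * r\<close> cleared.\<close>
  have "r * b\<^sup>2 + v * r * (y - b)\<^sup>2 = v * y\<^sup>2 + (r * b - v * y)\<^sup>2"
    unfolding r_def by (simp add: power2_eq_square algebra_simps)
  moreover have "b\<^sup>2 / (2 * v) + (y - b)\<^sup>2 / 2 = (r * b\<^sup>2 + v * r * (y - b)\<^sup>2) / (2 * v * r)"
    using v r by (simp add: add_divide_distrib)
  moreover have "y\<^sup>2 / (2 * r) + ((r * b - v * y) / r)\<^sup>2 / (2 * (v / r)) = (v * y\<^sup>2 + (r * b - v * y)\<^sup>2) / (2 * v * r)"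
    using v r by (simp add: add_divide_distrib power_divide power2_eq_square[of r])
  moreover have "b - v * y / r = (r * b - v * y) / r"
    using r by (simp add: diff_divide_distrib)
  ultimately have "- (b\<^sup>2 / (2 * v)) + - ((y - b)\<^sup>2 / 2)
    = - (y\<^sup>2 / (2 * r)) + - ((b - v * y / r)\<^sup>2 / (2 * (v / r)))"
    by simp
  then have e: "exp (- (b\<^sup>2 / (2 * v))) * exp (- ((y - b)\<^sup>2 / 2))
    = exp (- (y\<^sup>2 / (2 * r))) * exp (- ((b - v * y / r)\<^sup>2 / (2 * (v / r))))"
    unfolding exp_add[symmetric] by simp
  have q: "sqrt (2 * pi * v) * sqrt (2 * pi) = sqrt (2 * pi * r) * sqrt (2 * pi * (v / r))"
    using r by (simp add: real_sqrt_mult[symmetric])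
  have n: "normal_density b 1 y = exp (- ((y - b)\<^sup>2 / 2)) / sqrt (2 * pi)"
    by (simp add: normal_density_def)
  have vr: "0 < v / r" using v r by simp
  show ?thesis
    unfolding r_def[symmetric] normal_density_sqrt[OF v] normal_density_sqrt[OF r] normal_density_sqrt[OF vr] n
      times_divide_times_eq q diff_0_right e ..
qed

lemma normal_density_bounded: "\<bar>normal_density b 1 y\<bar> \<le> 1"
proof -
  have "1 \<le> sqrt (2 * pi)" using pi_ge_two by simp
  moreover have "exp (- (y - b)\<^sup>2 / 2) \<le> 1" by simp
  ultimately have "exp (- (y - b)\<^sup>2 / 2) \<le> sqrt (2 * pi)" by linarith
  then show ?thesis
    by (simp add: normal_density_def divide_le_eq)
qed

text \<open>For u = |b - y| the claim follows from u \<le> 1 + u^2 / 2 \<le> exp (u^2 / 2). A bound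
  uniform in b, here and in the preceding lemma, is what \<open>integrable_bind\<close> and
  \<open>integral_bind\<close> require.\<close>

lemma normal_density_moment_bounded: "\<bar>(b - y) * normal_density b 1 y\<bar> \<le> 1"
proof -
  have s: "1 \<le> sqrt (2 * pi)" using pi_ge_two by simp
  define u where "u = \<bar>b - y\<bar>"
  have u2: "u\<^sup>2 = (y - b)\<^sup>2"
    by (simp add: u_def power2_commute)
  have "(u - 1)\<^sup>2 = u\<^sup>2 - 2 * u + 1"
    by (simp add: power2_diff)
  then have "u \<le> 1 + u\<^sup>2 / 2"
    using zero_le_power2[of "u - 1"] zero_le_power2[of u] by linarith
  then have "\<bar>b - y\<bar> \<le> 1 + (y - b)\<^sup>2 / 2"
    unfolding u2 by (simp only: u_def)
  also have "\<dots> \<le> exp ((y - b)\<^sup>2 / 2)"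
    by (rule exp_ge_add_one_self)
  finally have "\<bar>b - y\<bar> * exp (- (y - b)\<^sup>2 / 2) \<le> 1"
    by (simp add: exp_minus divide_simps)
  with s have "\<bar>b - y\<bar> * exp (- (y - b)\<^sup>2 / 2) \<le> sqrt (2 * pi)" by linarith
  then show ?thesis
    by (simp add: normal_density_def abs_mult divide_le_eq)
qed

text \<open>For positive v the posterior is normal with mean v y / (1 + v), so its mean minus y is -
  y / (1 + v). The point mass at 0 for \<open>v = 0\<close> obeys the same formulas.\<close>

lemma integral_normal_distribution_normal_density:
  assumes "0 \<le> v"
  shows "(\<integral>b. normal_density b 1 y \<partial>normal_distribution 0 v) = normal_density 0 (sqrt (1 + v)) y"
    and "(\<integral>b. (b - y) * normal_density b 1 y \<partial>normal_distribution 0 v)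
      = - y / (1 + v) * normal_density 0 (sqrt (1 + v)) y"
proof -
  let ?m = "normal_density 0 (sqrt (1 + v)) y"
  have [measurable]: "(\<lambda>b. normal_density b 1 y) \<in> borel_measurable borel"
    unfolding normal_density_def by measurable
  have "(\<integral>b. normal_density b 1 y \<partial>normal_distribution 0 v) = ?m \<and>
    (\<integral>b. (b - y) * normal_density b 1 y \<partial>normal_distribution 0 v) = - y / (1 + v) * ?m"
  proof (cases "v = 0")
    case True
    then show ?thesis
      by (simp add: normal_distribution_def integral_return normal_density_def)
  next
    case False
    with assms have v: "0 < v" by simp
    let ?\<mu> = "v * y / (1 + v)" and ?\<sigma> = "sqrt (v / (1 + v))"
    have \<sigma>: "0 < ?\<sigma>" using v by simp
    have "(\<integral>b. normal_density b 1 y \<partial>normal_distribution 0 v)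
      = (\<integral>b. normal_density 0 (sqrt v) b * normal_density b 1 y \<partial>lborel)"
      using v by (simp add: normal_distribution_def integral_density)
    also have "\<dots> = ?m"
      using \<sigma> unfolding normal_density_times_normal_density[OF v] by simp
    finally have 1: "(\<integral>b. normal_density b 1 y \<partial>normal_distribution 0 v) = ?m" .
    have "(\<integral>b. (b - y) * normal_density b 1 y \<partial>normal_distribution 0 v)
      = (\<integral>b. (b - y) * (normal_density 0 (sqrt v) b * normal_density b 1 y) \<partial>lborel)"
      using v by (simp add: normal_distribution_def integral_density mult_ac)
    also have "\<dots> = (\<integral>b. ?m * (normal_density ?\<mu> ?\<sigma> b * b - y * normal_density ?\<mu> ?\<sigma> b) \<partial>lborel)"
      unfolding normal_density_times_normal_density[OF v] by (simp add: algebra_simps)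
    also have "\<dots> = ?m * (?\<mu> - y)"
      using \<sigma> by (simp add: integral_normal_moment_nz_1 integrable_normal_moment_nz_1)
    also have "?\<mu> - y = - y / (1 + v)"
      using v by (simp add: field_simps)
    finally show ?thesis using 1 by simp
  qed
  then show "(\<integral>b. normal_density b 1 y \<partial>normal_distribution 0 v) = ?m"
    "(\<integral>b. (b - y) * normal_density b 1 y \<partial>normal_distribution 0 v) = - y / (1 + v) * ?m"
    by auto
qed

text \<open>The conjugate formulas averaged over the half-Cauchy scale: \<open>m y s\<close> is the
  marginal density of y given s, and the weight 1 / (1 + s^2) is the shrinkage factor at that
  scale.\<close>

lemma horseshoe_prior_normal_integrals:
  defines "m \<equiv> \<lambda>y s. normal_density 0 (sqrt (1 + s\<^sup>2)) y"
  shows "integrable horseshoe_prior (\<lambda>b. normal_density b 1 y)"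
    and "integrable horseshoe_prior (\<lambda>b. (b - y) * normal_density b 1 y)"
    and "(\<integral>b. normal_density b 1 y \<partial>horseshoe_prior) = (\<integral>s. m y s \<partial>half_cauchy)"
    and "(\<integral>b. (b - y) * normal_density b 1 y \<partial>horseshoe_prior)
      = - y * (\<integral>s. m y s / (1 + s\<^sup>2) \<partial>half_cauchy)"
proof -
  interpret prob_space half_cauchy by (rule prob_space_half_cauchy)
  have [measurable]: "(\<lambda>b. normal_density b 1 y) \<in> borel_measurable borel"
    unfolding normal_density_def by measurable
  have N: "(\<lambda>s. normal_distribution 0 (s\<^sup>2)) \<in> measurable half_cauchy (subprob_algebra borel)"
    by (intro measurable_prob_algebraD) measurable
  have N1: "AE s in half_cauchy. emeasure (normal_distribution 0 (s\<^sup>2)) (space (normal_distribution 0 (s\<^sup>2))) \<le> ennreal 1"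
    using prob_space.emeasure_space_1[OF prob_space_normal_distribution] by auto
  note bound = normal_density_bounded[of _ y] normal_density_moment_bounded[of _ y]
  show "integrable horseshoe_prior (\<lambda>b. normal_density b 1 y)"
    unfolding horseshoe_prior_def
    by (rule integrable_bind[OF _ bound(1) N finite_measure_axioms N1]) measurable
  show "integrable horseshoe_prior (\<lambda>b. (b - y) * normal_density b 1 y)"
    unfolding horseshoe_prior_def
    by (rule integrable_bind[OF _ bound(2) N finite_measure_axioms N1]) measurable
  show "(\<integral>b. normal_density b 1 y \<partial>horseshoe_prior) = (\<integral>s. m y s \<partial>half_cauchy)"
    unfolding horseshoe_prior_def m_def
    by (subst integral_bind[OF _ bound(1) N finite_measure_axioms N1])
      (simp_all add: integral_normal_distribution_normal_density)
  have "(\<integral>b. (b - y) * normal_density b 1 y \<partial>horseshoe_prior) = (\<integral>s. - y * (m y s / (1 + s\<^sup>2)) \<partial>half_cauchy)"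
    unfolding horseshoe_prior_def m_def
    by (subst integral_bind[OF _ bound(2) N finite_measure_axioms N1])
      (simp_all add: integral_normal_distribution_normal_density)
  also have "\<dots> = - y * (\<integral>s. m y s / (1 + s\<^sup>2) \<partial>half_cauchy)"
    by (rule integral_mult_right_zero)
  finally show "(\<integral>b. (b - y) * normal_density b 1 y \<partial>horseshoe_prior)
      = - y * (\<integral>s. m y s / (1 + s\<^sup>2) \<partial>half_cauchy)" .
qed

section \<open>Tail estimates for numerator and denominator of the posterior shift\<close>

text \<open>Scales between t and 2 t suffice: the normal density at t is there at least of order 1 /
  t, and the half-Cauchy law gives this window a mass of the same order.\<close>

lemma horseshoe_marginal_lower_bound:
  obtains C where "0 < C" "\<And>t. 1 \<le> t \<Longrightarrow> C / t\<^sup>2 \<le> (\<integral>s. normal_density 0 (sqrt (1 + s\<^sup>2)) t \<partial>half_cauchy)"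
proof
  interpret prob_space half_cauchy by (rule prob_space_half_cauchy)
  \<comment> \<open>On the window t^2 \<le> 1 + s^2 \<le> 5 t^2. The lower estimate bounds the
    exponential by \<open>exp (- 1 / 2)\<close>; the upper one bounds the normal density below by
    \<open>?a / t\<close> and the half-Cauchy density by \<open>?b / t^2\<close>.\<close>
  let ?a = "exp (- 1 / 2) / sqrt (10 * pi)" and ?b = "2 / (5 * pi)"
  show "0 < ?a * ?b" by simp
  fix t :: real assume t: "1 \<le> t"
  let ?m = "\<lambda>s. normal_density 0 (sqrt (1 + s\<^sup>2)) t"
  have t2: "1 \<le> t\<^sup>2" using t by simp
  have sq: "1 + s\<^sup>2 \<le> 5 * t\<^sup>2" "t\<^sup>2 \<le> 1 + s\<^sup>2" if "s \<in> {t..2 * t}" for s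
  proof -
    have "s\<^sup>2 \<le> (2 * t)\<^sup>2" "t\<^sup>2 \<le> s\<^sup>2"
      using that t by (intro power_mono; simp)+
    then show "1 + s\<^sup>2 \<le> 5 * t\<^sup>2" "t\<^sup>2 \<le> 1 + s\<^sup>2" using t2 by (auto simp: power_mult_distrib)
  qed
  have meas: "?m \<in> borel_measurable borel"
    unfolding normal_density_def by measurable
  have m_le: "?m s \<le> 1" for s
  proof -
    have "0 \<le> s\<^sup>2" by simp
    then have "1 \<le> 2 * pi * (1 + s\<^sup>2)" using pi_ge_two mult_mono[of 1 "2 * pi" 1 "1 + s\<^sup>2"] by simp
    then have "1 \<le> sqrt (2 * pi * (1 + s\<^sup>2))" by simp
    moreover have "exp (- t\<^sup>2 / (2 * (1 + s\<^sup>2))) \<le> 1" by simp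
    ultimately have "exp (- t\<^sup>2 / (2 * (1 + s\<^sup>2))) \<le> sqrt (2 * pi * (1 + s\<^sup>2))"
      "0 < sqrt (2 * pi * (1 + s\<^sup>2))"
      by linarith+
    then have "exp (- t\<^sup>2 / (2 * (1 + s\<^sup>2))) / sqrt (2 * pi * (1 + s\<^sup>2)) \<le> 1"
      by (simp only: divide_le_eq_1_pos)
    then show ?thesis by (simp add: normal_density_def)
  qed
  have H: "?b / t \<le> measure half_cauchy {t..2 * t}"
  proof -
    have "ennreal (?b / t\<^sup>2) * emeasure lborel {t..2 * t}
      = (\<integral>\<^sup>+s. ennreal (?b / t\<^sup>2) * indicator {t..2 * t} s \<partial>lborel)"
      by (simp add: nn_integral_cmult_indicator)
    also have "\<dots> \<le> (\<integral>\<^sup>+s. ennreal (if 0 < s then 2 / (pi * (1 + s\<^sup>2)) else 0) * indicator {t..2 * t} s \<partial>lborel)"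
    proof (intro nn_integral_mono)
      fix s :: real
      show "ennreal (?b / t\<^sup>2) * indicator {t..2 * t} s
        \<le> ennreal (if 0 < s then 2 / (pi * (1 + s\<^sup>2)) else 0) * indicator {t..2 * t} s"
      proof (cases "s \<in> {t..2 * t}")
        case True
        have "0 < 1 + s\<^sup>2" using zero_le_power2[of s] by linarith
        then have "2 / (pi * (5 * t\<^sup>2)) \<le> 2 / (pi * (1 + s\<^sup>2))"
          using sq(1)[OF True] by (intro divide_left_mono mult_left_mono mult_pos_pos) auto
        then show ?thesis
          using True t by (auto intro!: ennreal_leI simp: mult_ac)
      qed simp
    qed
    also have "\<dots> = emeasure half_cauchy {t..2 * t}"
      by (simp add: half_cauchy_def emeasure_density)
    finally have "ennreal (?b / t\<^sup>2 * t) \<le> ennreal (measure half_cauchy {t..2 * t})"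
      using t by (simp add: emeasure_eq_measure ennreal_mult''[symmetric])
    moreover have "?b / t\<^sup>2 * t = ?b / t" using t by (simp add: power2_eq_square)
    ultimately show ?thesis by simp
  qed
  have "?a * ?b / t\<^sup>2 = ?a / t * (?b / t)" by (simp add: power2_eq_square)
  also have "\<dots> \<le> ?a / t * measure half_cauchy {t..2 * t}"
    using t by (intro mult_left_mono H) auto
  also have "\<dots> = (\<integral>s. ?a / t * indicator {t..2 * t} s \<partial>half_cauchy)"
    by simp
  also have "\<dots> \<le> (\<integral>s. ?m s \<partial>half_cauchy)"
  proof (rule integral_mono)
    show "integrable half_cauchy ?m"
      using meas m_le by (intro integrable_const_bound[where B=1]) auto
    show "integrable half_cauchy (\<lambda>s. ?a / t * indicator {t..2 * t} s)"
      by (intro integrable_mult_right integrable_real_indicator) (auto simp: emeasure_eq_measure)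
    fix s
    show "?a / t * indicator {t..2 * t} s \<le> ?m s"
    proof (cases "s \<in> {t..2 * t}")
      case True
      have p: "0 < 1 + s\<^sup>2" using zero_le_power2[of s] by linarith
      have "exp (- 1 / 2) \<le> exp (- t\<^sup>2 / (2 * (1 + s\<^sup>2)))"
        using sq(2)[OF True] p by (simp add: divide_simps)
      moreover have "sqrt (2 * pi * (1 + s\<^sup>2)) \<le> sqrt (10 * pi) * t"
      proof -
        have "2 * pi * (1 + s\<^sup>2) \<le> 2 * pi * (5 * t\<^sup>2)"
          using sq(1)[OF True] by (intro mult_left_mono) auto
        then have "sqrt (2 * pi * (1 + s\<^sup>2)) \<le> sqrt (10 * pi * t\<^sup>2)"
          by (intro real_sqrt_le_mono) simp
        also have "\<dots> = sqrt (10 * pi) * t" using t by (simp add: real_sqrt_mult)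
        finally show ?thesis .
      qed
      ultimately have "exp (- 1 / 2) / (sqrt (10 * pi) * t) \<le> exp (- t\<^sup>2 / (2 * (1 + s\<^sup>2))) / sqrt (2 * pi * (1 + s\<^sup>2))"
        using p by (intro frac_le) auto
      then show ?thesis using True p by (simp add: normal_density_def)
    qed simp
  qed
  finally show "?a * ?b / t\<^sup>2 \<le> (\<integral>s. ?m s \<partial>half_cauchy)" .
qed

text \<open>Both bounds come from exp u \<ge> 1 + u + u^2 / 2 at u = x^2 / 2. The constant serves as
  dominating function, the bound 8 / x gives pointwise decay.\<close>

lemma power3_times_gaussian:
  fixes x :: real
  assumes "0 \<le> x"
  shows "x ^ 3 * exp (- x\<^sup>2 / 2) \<le> 4" and "0 < x \<Longrightarrow> x ^ 3 * exp (- x\<^sup>2 / 2) \<le> 8 / x"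
proof -
  have e: "1 + x\<^sup>2 / 2 + (x\<^sup>2 / 2)\<^sup>2 / 2 \<le> exp (x\<^sup>2 / 2)"
    by (rule exp_lower_Taylor_quadratic) simp
  have "x ^ 3 \<le> 4 * (1 + x\<^sup>2 / 2 + (x\<^sup>2 / 2)\<^sup>2 / 2)"
  proof -
    \<comment> \<open>With the factor 4 the square of x (x - 1) accounts for the cubic term.\<close>
    have "4 * (1 + x\<^sup>2 / 2 + (x\<^sup>2 / 2)\<^sup>2 / 2) - x ^ 3 = 4 + (x * (x - 1))\<^sup>2 / 2 + 3 / 2 * x\<^sup>2"
      by (simp add: power2_eq_square power3_eq_cube field_simps)
    moreover have "0 \<le> 4 + (x * (x - 1))\<^sup>2 / 2 + 3 / 2 * x\<^sup>2" by simp
    ultimately show ?thesis by linarith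
  qed
  also have "\<dots> \<le> 4 * exp (x\<^sup>2 / 2)"
    using e by simp
  finally show "x ^ 3 * exp (- x\<^sup>2 / 2) \<le> 4"
    by (simp add: exp_minus divide_simps)
  assume x: "0 < x"
  have "x ^ 3 * x = 8 * ((x\<^sup>2 / 2)\<^sup>2 / 2)"
    by (simp add: power2_eq_square power3_eq_cube)
  also have "\<dots> \<le> 8 * (1 + x\<^sup>2 / 2 + (x\<^sup>2 / 2)\<^sup>2 / 2)" by simp
  also have "\<dots> \<le> 8 * exp (x\<^sup>2 / 2)"
    using e by simp
  finally show "x ^ 3 * exp (- x\<^sup>2 / 2) \<le> 8 / x"
    using x by (simp add: exp_minus divide_simps)
qed

text \<open>With x = t / sqrt (1 + s^2) the integrand becomes x^3 exp (- x^2 / 2) / sqrt (2 pi). It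
  is bounded by 4 and tends to 0 for each fixed s, so dominated convergence applies.\<close>

lemma horseshoe_shrinkage_decay:
  "((\<lambda>t. t ^ 3 * (\<integral>s. normal_density 0 (sqrt (1 + s\<^sup>2)) t / (1 + s\<^sup>2) \<partial>half_cauchy)) \<longlongrightarrow> 0) at_top"
proof -
  interpret prob_space half_cauchy by (rule prob_space_half_cauchy)
  let ?q = "\<lambda>t s :: real. t ^ 3 * (normal_density 0 (sqrt (1 + s\<^sup>2)) t / (1 + s\<^sup>2))"
  let ?x = "\<lambda>t s :: real. t / sqrt (1 + s\<^sup>2)"
  have c: "0 < 1 + s\<^sup>2" for s :: real
    using zero_le_power2[of s] by linarith
  \<comment> \<open>The normal density contributes 1 / sqrt (1 + s^2) and the shrinkage factor 1 /
    (1 + s^2); together they match t^3.\<close>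
  have q_eq: "?q t s = ?x t s ^ 3 * exp (- (?x t s)\<^sup>2 / 2) / sqrt (2 * pi)" for t s
  proof -
    define c where "c = 1 + s\<^sup>2"
    have "0 < c" using c by (simp add: c_def)
    then have r: "sqrt c ^ 3 = c * sqrt c" "(sqrt c)\<^sup>2 = c" by (simp_all add: power3_eq_cube)
    show ?thesis
      unfolding c_def[symmetric] normal_density_def power_divide r
      by (simp add: real_sqrt_mult mult_ac)
  qed
  have q_le: "\<bar>?q t s\<bar> \<le> ?x t s ^ 3 * exp (- (?x t s)\<^sup>2 / 2)" if "0 \<le> t" for t s
  proof -
    have "1 \<le> sqrt (2 * pi)" using pi_ge_two by simp
    moreover have "0 \<le> ?x t s ^ 3 * exp (- (?x t s)\<^sup>2 / 2)" using that by simp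
    ultimately show ?thesis
      unfolding q_eq by (simp add: divide_le_eq mult_le_cancel_left1 del: zero_le_mult_iff)
  qed
  have "((\<lambda>t. \<integral>s. ?q t s \<partial>half_cauchy) \<longlongrightarrow> (\<integral>s. 0 \<partial>half_cauchy)) at_top"
  proof (rule integral_dominated_convergence_at_top)
    show "?q t \<in> borel_measurable half_cauchy" for t
      unfolding normal_density_def by measurable
    show "integrable half_cauchy (\<lambda>_. 4 :: real)" by simp
    show "AE s in half_cauchy. ((\<lambda>t. ?q t s) \<longlongrightarrow> 0) at_top"
    proof (rule AE_I2)
      fix s :: real
      show "((\<lambda>t. ?q t s) \<longlongrightarrow> 0) at_top"
      proof (rule Lim_null_comparison)
        show "\<forall>\<^sub>F t in at_top. norm (?q t s) \<le> 8 * sqrt (1 + s\<^sup>2) / t"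
          using eventually_gt_at_top[of 0]
        proof eventually_elim
          case (elim t)
          then have "0 < ?x t s" using c[of s] by simp
          with q_le[of t s] power3_times_gaussian(2)[of "?x t s"] elim show ?case by simp
        qed
        show "((\<lambda>t. 8 * sqrt (1 + s\<^sup>2) / t) \<longlongrightarrow> 0) at_top"
          by (intro tendsto_divide_0[OF tendsto_const] filterlim_at_top_imp_at_infinity filterlim_ident)
      qed
    qed
    show "\<forall>\<^sub>F t in at_top. AE s in half_cauchy. norm (?q t s) \<le> 4"
      using eventually_ge_at_top[of 0]
    proof eventually_elim
      case (elim t)
      show ?case
      proof (rule AE_I2)
        fix s :: real
        have "0 \<le> ?x t s" using elim by simp
        with q_le[OF elim, of s] power3_times_gaussian(1)[of "?x t s"] show "norm (?q t s) \<le> 4" by simp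
      qed
    qed
  qed simp
  then show ?thesis
    by (simp only: integral_mult_right_zero integral_zero)
qed

text \<open>Writing b = (b - y) + y in Bayes' formula isolates y; the rest is the centred moment
  divided by the marginal density of y.\<close>

lemma horseshoe_posterior_mean:
  "posterior_mean horseshoe_prior y - y =
    - y * (\<integral>s. normal_density 0 (sqrt (1 + s\<^sup>2)) y / (1 + s\<^sup>2) \<partial>half_cauchy) /
      (\<integral>s. normal_density 0 (sqrt (1 + s\<^sup>2)) y \<partial>half_cauchy)"
  if Z: "0 < (\<integral>s. normal_density 0 (sqrt (1 + s\<^sup>2)) y \<partial>half_cauchy)"
proof -
  note h = horseshoe_prior_normal_integrals[of y]
  define Z where "Z = (\<integral>b. normal_density b 1 y \<partial>horseshoe_prior)"
  have Z: "0 < Z" unfolding Z_def h(3) by (fact that)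
  have [measurable_cong]: "sets horseshoe_prior = sets borel"
    unfolding horseshoe_prior_eq_bind by (intro sets_bind) auto
  have [measurable]: "(\<lambda>b. normal_density b 1 y) \<in> borel_measurable borel"
    unfolding normal_density_def by measurable
  have "posterior_mean horseshoe_prior y = (\<integral>b. normal_density b 1 y / Z * b \<partial>horseshoe_prior)"
    unfolding posterior_mean_def posterior_def Z_def[symmetric]
    using Z by (subst integral_density) auto
  also have "\<dots> = (\<integral>b. ((b - y) * normal_density b 1 y + y * normal_density b 1 y) / Z \<partial>horseshoe_prior)"
    by (intro Bochner_Integration.integral_cong) (auto simp: field_simps)
  also have "\<dots> = ((\<integral>b. (b - y) * normal_density b 1 y \<partial>horseshoe_prior) + y * Z) / Z"
    using h(1,2) by (simp add: Z_def)
  also have "\<dots> = (\<integral>b. (b - y) * normal_density b 1 y \<partial>horseshoe_prior) / Z + y"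
    using Z by (simp add: field_simps)
  finally show ?thesis
    unfolding Z_def h(3,4) by simp
qed

text \<open>The shift has modulus |y| N / Z. The lower bound C / y^2 for Z costs two more powers of
  |y|, exactly the three that the decay of N absorbs.\<close>

lemma horseshoe_bounded_influence:
  "((\<lambda>y. posterior_mean horseshoe_prior y - y) \<longlongrightarrow> 0) at_infinity"
proof -
  let ?N = "\<lambda>y. \<integral>s. normal_density 0 (sqrt (1 + s\<^sup>2)) y / (1 + s\<^sup>2) \<partial>half_cauchy"
  let ?Z = "\<lambda>y. \<integral>s. normal_density 0 (sqrt (1 + s\<^sup>2)) y \<partial>half_cauchy"
  \<comment> \<open>Both integrals are even in y, so estimates as t tends to infinity cover both
    directions.\<close>
  have abs: "?N y = ?N \<bar>y\<bar>" "?Z y = ?Z \<bar>y\<bar>" for y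
    by (simp_all add: normal_density_def)
  have N: "0 \<le> ?N y" for y
    by (intro integral_nonneg_AE AE_I2) auto
  obtain C where C: "0 < C" "\<And>t. 1 \<le> t \<Longrightarrow> C / t\<^sup>2 \<le> ?Z t"
    by (rule horseshoe_marginal_lower_bound) blast
  have "((\<lambda>t. t ^ 3 * ?N t / C) \<longlongrightarrow> 0) at_top"
    using tendsto_divide[OF horseshoe_shrinkage_decay tendsto_const[of C]] C(1) by simp
  from filterlim_compose[OF this filterlim_norm_at_top[where 'a=real]]
  have "((\<lambda>y. \<bar>y\<bar> ^ 3 * ?N \<bar>y\<bar> / C) \<longlongrightarrow> 0) at_infinity"
    unfolding real_norm_def .
  moreover have "\<forall>\<^sub>F y in at_infinity. norm (posterior_mean horseshoe_prior y - y) \<le> \<bar>y\<bar> ^ 3 * ?N \<bar>y\<bar> / C"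
    unfolding eventually_at_infinity
  proof (intro exI[of _ 1] allI impI)
    fix y :: real assume "1 \<le> norm y"
    then have y: "1 \<le> \<bar>y\<bar>" by simp
    then have p: "0 < C / \<bar>y\<bar>\<^sup>2" using C(1) by simp
    have Z: "C / \<bar>y\<bar>\<^sup>2 \<le> ?Z y" unfolding abs(2)[of y] using y by (rule C(2))
    then have "0 < ?Z y" using p by linarith
    from horseshoe_posterior_mean[OF this] \<open>0 < ?Z y\<close>
    have "norm (posterior_mean horseshoe_prior y - y) = \<bar>y\<bar> * ?N y / ?Z y"
      using N[of y] by (simp add: abs_mult)
    also have "\<dots> \<le> \<bar>y\<bar> * ?N y / (C / \<bar>y\<bar>\<^sup>2)"
      using Z p N[of y] by (intro divide_left_mono mult_nonneg_nonneg mult_pos_pos) auto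
    also have "\<dots> = \<bar>y\<bar> ^ 3 * ?N y / C"
      by (simp add: power3_eq_cube power2_eq_square)
    finally show "norm (posterior_mean horseshoe_prior y - y) \<le> \<bar>y\<bar> ^ 3 * ?N \<bar>y\<bar> / C"
      unfolding abs(1)[of y] .
  qed
  ultimately show ?thesis
    by (rule Lim_null_comparison[rotated])
qed

theorem proposition7:
  fixes G :: nat and p :: "nat \<Rightarrow> nat" and a\<^sub>G a\<^sub>2 :: real and c :: "nat \<Rightarrow> real" and g :: nat
  assumes p_pos: "\<And>h. h \<in> {1..G} \<Longrightarrow> 1 \<le> p h"
    and a\<^sub>G_pos: "0 < a\<^sub>G"
    and a\<^sub>2_pos: "0 < a\<^sub>2"
    and c_eq: "\<And>h. h \<in> {1..G} \<Longrightarrow> c h = a\<^sub>G / real (p h)"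
    and g: "g \<in> {1..G}"
    and c_half: "c g = 1 / 2"
    and a\<^sub>2_half: "a\<^sub>2 = 1 / 2"
  shows "\<forall>l\<in>{1..p g}.
           group_R2_marginal G p a\<^sub>G a\<^sub>2 c g l = horseshoe_prior \<and>
           ((\<lambda>y. posterior_mean (group_R2_marginal G p a\<^sub>G a\<^sub>2 c g l) y - y) \<longlongrightarrow> 0) at_infinity"
proof
  fix l assume l: "l \<in> {1..p g}"
  have "group_R2_marginal G p a\<^sub>G a\<^sub>2 c g l = beta_prime_distribution (c g) a\<^sub>2 \<bind> normal_distribution 0"
    using p_pos a\<^sub>G_pos a\<^sub>2_pos c_eq g l by (rule group_R2_marginal_eq_bind)
  \<comment> \<open>For these parameters both sides are normal mixtures over the same Beta prime
    variance.\<close>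
  then have "group_R2_marginal G p a\<^sub>G a\<^sub>2 c g l = horseshoe_prior"
    unfolding c_half a\<^sub>2_half horseshoe_prior_eq_bind .
  then show "group_R2_marginal G p a\<^sub>G a\<^sub>2 c g l = horseshoe_prior \<and>
      ((\<lambda>y. posterior_mean (group_R2_marginal G p a\<^sub>G a\<^sub>2 c g l) y - y) \<longlongrightarrow> 0) at_infinity"
    using horseshoe_bounded_influence by simp
qed

end
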